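(* Let $T:\mathbb{R}^n\to\mathbb{R}^n$ be an invertible linear transform. For all $\psi_1,\dots,\psi_n\in Conv(0,\infty)$ and $K_1,\dots,K_n\in C^2_+$, $$as^*(\psi_1,TK_1;\cdots;\psi_n,TK_n)=as^*(\psi_1,K_1;\cdots;\psi_n,K_n)\quad\text{if }|\det(T)|=1.$$ If in addition (for arbitrary invertible $T$) all $\psi_i$ are homogeneous of degrees $r_i\in(-\infty,0]$, then $$as^*(\psi_1,TK_1;\cdots;\psi_n,TK_n)=|\det(T)|^{\frac{2\sum_{i=1}^nr_i}{n}-1}\,as^*(\psi_1,K_1;\cdots;\psi_n,K_n).$$
   Context: Let $n\ge2$. $S^{n-1}$ is the unit sphere of $\mathbb{R}^n$ and $\sigma$ the usual surface area measure on it. $K\in C^2_+$ means that $K$ is a convex body in $\mathbb{R}^n$ with the origin in its interior and with $C^2$ boundary having everywhere strictly positive Gaussian curvature. $h_K(u)=\max_{x\in K}\langle x,u\rangle$ is the support function, and the curvature function $f_K(u)$, $u\in S^{n-1}$, is the reciprocal of the Gauss curvature of $\partial K$ at the point with outer unit normal $u$. $Conv(0,\infty)$ is the set of functions $\psi:(0,\infty)\to(0,\infty)$ such that either $\psi$ is a nonzero constant function, or $\psi$ is convex with $\lim_{t\to0}\psi(t)=\infty$ and $\lim_{t\to\infty}\psi(t)=0$. $\psi$ is homogeneous of degree $r$ if $\psi(\lambda t)=\lambda^r\psi(t)$ for all $\lambda,t>0$. The general mixed $L_\psi^*$-affine surface area, for $\psi_i\in Conv(0,\infty)$ and $K_i\in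 C^2_+$, is $$as^*(\psi_1,K_1;\cdots;\psi_n,K_n)=\int_{S^{n-1}}\prod_{i=1}^n\left[\frac{\psi_i\big(f_{K_i}(u)h_{K_i}^{n+1}(u)\big)}{h_{K_i}(u)^n}\right]^{\frac1n}d\sigma(u).$$ *)

theory Defs
  imports "HOL-Analysis.Analysis"
begin

text \<open>The surface area measure on the unit sphere, in its cone form:
  \<open>\<sigma>(A) = n \<cdot> vol {t u | u \<in> A, 0 < t < 1}\<close> for Borel sets \<open>A\<close> of unit vectors.\<close>

definition sphere_measure :: "(real ^ 'n::finite) measure" where
  "sphere_measure =
     scale_measure (of_nat CARD('n))
       (distr (restrict_space lborel (ball 0 1 - {0}))
              (restrict_space borel (sphere 0 1))
              (\<lambda>x. x /\<^sub>R norm x))"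

text \<open>An embedded \<open>C\<^sup>2\<close> hypersurface: locally a regular level set of a \<open>C\<^sup>2\<close> function
  \<open>\<rho>\<close>, with gradient \<open>g\<close> and Hessian matrix \<open>H\<close>.\<close>

definition C2_hypersurface :: "(real ^ 'n::finite) set \<Rightarrow> bool" where
  "C2_hypersurface S \<longleftrightarrow>
     (\<forall>p\<in>S. \<exists>U (\<rho> :: real ^ 'n \<Rightarrow> real) (g :: real ^ 'n \<Rightarrow> real ^ 'n) (H :: real ^ 'n \<Rightarrow> real ^ 'n ^ 'n).
        open U \<and> p \<in> U \<and> S \<inter> U = {x \<in> U. \<rho> x = 0} \<and>
        (\<forall>x\<in>U. (\<rho> has_derivative (\<lambda>v. g x \<bullet> v)) (at x) \<and>
               (g has_derivative (\<lambda>v. H x *v v)) (at x) \<and>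
               g x \<noteq> 0) \<and>
        continuous_on U H)"

definition convex_body :: "(real ^ 'n::finite) set \<Rightarrow> bool" where
  "convex_body K \<longleftrightarrow> convex K \<and> compact K \<and> interior K \<noteq> {}"

text \<open>The Gauss map of the boundary of a convex body; the outer unit normal is unique at every
  boundary point when the boundary is differentiable.\<close>

definition outer_normal :: "(real ^ 'n::finite) set \<Rightarrow> real ^ 'n \<Rightarrow> real ^ 'n" where
  "outer_normal K p = (THE u. norm u = 1 \<and> (\<forall>y\<in>K. y \<bullet> u \<le> p \<bullet> u))"

text \<open>The Gauss curvature at \<open>p\<close> is the determinant of the Weingarten map, i.e. of the
  differential \<open>D\<close> of the Gauss map as an endomorphism of the tangent space \<open>u\<^sup>\<bottom>\<close>.
  A derivative within the boundary is determined by the boundary only on \<open>u\<^sup>\<bottom>\<close>, so \<open>D\<close> is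
  used only there; the determinant on \<open>u\<^sup>\<bottom>\<close> is computed as that of the extension to the whole
  space by the identity on the normal line.\<close>

definition gauss_curvature :: "(real ^ 'n::finite) set \<Rightarrow> real ^ 'n \<Rightarrow> real" where
  "gauss_curvature K p =
     (let u = outer_normal K p;
          D = (SOME D. (outer_normal K has_derivative D) (at p within frontier K))
      in det (matrix (\<lambda>x. D (x - (x \<bullet> u) *\<^sub>R u) + (x \<bullet> u) *\<^sub>R u)))"

definition C2_plus :: "(real ^ 'n::finite) set set" where
  "C2_plus = {K. convex_body K \<and> 0 \<in> interior K \<and> C2_hypersurface (frontier K) \<and>
                 (\<forall>p\<in>frontier K. gauss_curvature K p > 0)}"

definition support_function :: "(real ^ 'n::finite) set \<Rightarrow> real ^ 'n \<Rightarrow> real" where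
  "support_function K u = (SUP x\<in>K. x \<bullet> u)"

definition curvature_function :: "(real ^ 'n::finite) set \<Rightarrow> real ^ 'n \<Rightarrow> real" where
  "curvature_function K u = 1 / gauss_curvature K (THE p. p \<in> frontier K \<and> outer_normal K p = u)"

text \<open>Functions \<open>(0,\<infinity>) \<Rightarrow> (0,\<infinity>)\<close> are represented by functions on the reals of which only the
  values on the positive half-line matter.\<close>

definition Conv_pos :: "(real \<Rightarrow> real) set" where
  "Conv_pos = {\<psi>. (\<forall>t>0. \<psi> t > 0) \<and>
     ((\<exists>c. c \<noteq> 0 \<and> (\<forall>t>0. \<psi> t = c)) \<or>
      (convex_on {0<..} \<psi> \<and> filterlim \<psi> at_top (at_right 0) \<and> (\<psi> \<longlongrightarrow> 0) at_top))}"

definition homogeneous_of_degree :: "real \<Rightarrow> (real \<Rightarrow> real) \<Rightarrow> bool" where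
  "homogeneous_of_degree r \<psi> \<longleftrightarrow> (\<forall>c>0. \<forall>t>0. \<psi> (c * t) = c powr r * \<psi> t)"

text \<open>The general mixed \<open>L\<^sub>\<psi>\<^sup>*\<close>-affine surface area.  The \<open>n\<close> pairs \<open>(\<psi>\<^sub>i, K\<^sub>i)\<close> are indexed
  by the type \<open>'n\<close>, which also indexes the coordinates and has \<open>n\<close> elements.\<close>

definition as_star :: "('n::finite \<Rightarrow> real \<Rightarrow> real) \<Rightarrow> ('n \<Rightarrow> (real ^ 'n) set) \<Rightarrow> real" where
  "as_star \<psi> K =
     (LINT u|sphere_measure.
        (\<Prod>i\<in>UNIV. (\<psi> i (curvature_function (K i) u * support_function (K i) u ^ (CARD('n) + 1))
                    / support_function (K i) u ^ CARD('n)) powr (1 / CARD('n))))"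

end

theory Submission
  imports Defs
begin

text \<open>To a boundary point \<open>p\<close> of \<open>K\<close> with outer unit normal \<open>u\<close> belongs the dual point
  \<open>\<nu> = u / (p \<bullet> u)\<close>.  Under \<open>T\<close> dual points transform linearly, by \<open>T\<^sup>-\<^sup>t\<close>.  The differential of
  \<open>p \<mapsto> \<nu>\<close>, as a map from \<open>u\<^sup>\<bottom>\<close> to \<open>p\<^sup>\<bottom>\<close> extended by \<open>p \<mapsto> \<nu>\<close>, therefore becomes
  \<open>T\<^sup>-\<^sup>t \<Lambda> T\<^sup>-\<^sup>1\<close>, and its determinant is \<open>1 / (f\<^sub>K(u) h\<^sub>K(u)\<^sup>n\<^sup>+\<^sup>1)\<close>.  Hence \<open>f h\<^sup>n\<^sup>+\<^sup>1\<close> at \<open>u\<close> for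
  \<open>T K\<close> is \<open>(det T)\<^sup>2\<close> times its value for \<open>K\<close> at \<open>v = T\<^sup>t u / |T\<^sup>t u|\<close>, while
  \<open>h\<^sub>T\<^sub>K(u) = |T\<^sup>t u| h\<^sub>K(v)\<close>.  The remaining factor \<open>|T\<^sup>t u|\<^sup>-\<^sup>n\<close> is, up to \<open>|det T|\<close>, the Jacobian
  of \<open>u \<mapsto> v\<close> on the sphere.\<close>

section \<open>Linear images of Lebesgue measure\<close>

text \<open>A derivative within the boundary is unique only along the tangent hyperplane, so the
  differential chosen by \<open>SOME\<close> in \<open>gauss_curvature\<close> has uncontrolled
  values elsewhere. To compare it with an explicit derivative, every vector of that hyperplane must
  be a limit of secants of the boundary. \<open>regular_body\<close> records this together with
  unique, differentiable dual points. These properties are phrased through inner products and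
  secants, so they pass from \<open>K\<close> to its image under \<open>T\<close> by linear algebra.
  Membership of the image in \<open>C2_plus\<close> is never established: its curvature is nonzero
  by the transformation formula, and that already makes its Gauss map injective. The integrand of
  \<open>as_star\<close> is not shown to be measurable either. The change of variables on the sphere
  is therefore proved for arbitrary real functions, including those whose Bochner integral is 0 by
  convention.\<close>

text \<open>\<open>measure_linear_image\<close> is available only for wellordered index types; the copy below
  transports it to arbitrary finite ones.\<close>

typedef 'n wellordered_copy = "UNIV :: 'n set" by simp

lemma bij_Rep_wellordered_copy: "bij (Rep_wellordered_copy :: 'n wellordered_copy \<Rightarrow> 'n)"
  by (rule o_bij[of Abs_wellordered_copy])
    (auto simp: fun_eq_iff Abs_wellordered_copy_inverse Rep_wellordered_copy_inverse)

instance wellordered_copy :: (finite) finite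
proof
  have "finite (range (Rep_wellordered_copy :: 'a wellordered_copy \<Rightarrow> 'a))" by simp
  then show "finite (UNIV :: 'a wellordered_copy set)"
    using bij_Rep_wellordered_copy bij_is_inj finite_imageD by blast
qed

text \<open>An index type carries no order of its own. An arbitrary injection into the naturals
  supplies one, and determinants and Lebesgue measure do not depend on the choice.\<close>

definition wellordered_copy_index :: "'n::finite wellordered_copy \<Rightarrow> nat" where
  "wellordered_copy_index = (SOME f. inj f)"

lemma inj_wellordered_copy_index: "inj (wellordered_copy_index :: 'n::finite wellordered_copy \<Rightarrow> nat)"
proof -
  obtain f :: "'n wellordered_copy \<Rightarrow> nat" where "inj f"
    using finite_imp_inj_to_nat_seg[OF finite[of UNIV]] by metis
  then show ?thesis
    unfolding wellordered_copy_index_def by (rule someI[of "\<lambda>f. inj f"])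
qed

instantiation wellordered_copy :: (finite) wellorder
begin

definition "x \<le> y \<longleftrightarrow> wellordered_copy_index x \<le> wellordered_copy_index y"
definition "x < y \<longleftrightarrow> wellordered_copy_index x < wellordered_copy_index y"

instance
proof
  fix P :: "'a wellordered_copy \<Rightarrow> bool" and a
  assume *: "\<And>x. (\<And>y. y < x \<Longrightarrow> P y) \<Longrightarrow> P x"
  show "P a"
  proof (induction a rule: measure_induct_rule[of wellordered_copy_index])
    case (less x)
    then show ?case using *[of x] by (simp add: less_wellordered_copy_def)
  qed
next
  fix x y :: "'a wellordered_copy"
  show "x \<le> y \<Longrightarrow> y \<le> x \<Longrightarrow> x = y"
    by (simp add: less_eq_wellordered_copy_def inj_eq[OF inj_wellordered_copy_index])
qed (auto simp: less_eq_wellordered_copy_def less_wellordered_copy_def)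

end

text \<open>Conjugation by \<open>f\<close> turns the transposition of \<open>a\<close> and
  \<open>b\<close> into that of \<open>f a\<close> and \<open>f b\<close>, so both signs flip
  together when a permutation is built up from transpositions.\<close>

lemma sign_conj_bij:
  fixes f :: "'a::finite \<Rightarrow> 'b::finite"
  assumes "bij f" "p permutes UNIV"
  shows "sign (f \<circ> p \<circ> inv f) = sign p"
  using assms(2) finite[of UNIV]
proof (induction p rule: permutes_induct)
  case id
  then show ?case
    using assms(1) by (simp add: o_def bij_is_surj surj_f_inv_f sign_id[unfolded id_def])
next
  case (swap a b p)
  have "f \<circ> (Transposition.transpose a b \<circ> p) \<circ> inv f = Transposition.transpose (f a) (f b) \<circ> (f \<circ> p \<circ> inv f)"
  proof
    fix x show "(f \<circ> (Transposition.transpose a b \<circ> p) \<circ> inv f) x = (Transposition.transpose (f a) (f b) \<circ> (f \<circ> p \<circ> inv f)) x"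
      using bij_is_inj[OF assms(1)] by (auto simp: Transposition.transpose_def inj_eq)
  qed
  moreover have "permutation p" "permutation (f \<circ> p \<circ> inv f)"
    using permutes_bij[OF \<open>p permutes UNIV\<close>] assms(1) by (auto simp: permutation intro!: bij_comp bij_imp_bij_inv)
  moreover have "f a \<noteq> f b" using bij_is_inj[OF assms(1)] \<open>a \<noteq> b\<close> by (simp add: inj_eq)
  ultimately show ?case
    using \<open>a \<noteq> b\<close> swap.IH by (simp only: if_False sign_compose permutation_swap_id sign_swap_id)
qed

text \<open>Conjugation with \<open>f\<close> permutes the terms of the Leibniz sum and preserves
  signs; inside each term the product over rows is reindexed by \<open>f\<close> itself.\<close>

lemma det_reindex:
  fixes f :: "'m::finite \<Rightarrow> 'n::finite" and A :: "'a::comm_ring_1^'n^'n"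
  assumes "bij f"
  shows "det (\<chi> i j. A $ f i $ f j) = det A"
proof -
  have b: "bij_betw (\<lambda>p. f \<circ> p \<circ> inv f) {p. p permutes UNIV} {p. p permutes UNIV}"
    using assms
  proof (intro bij_betwI[where g = "\<lambda>q. inv f \<circ> q \<circ> f"])
    have "f \<circ> p \<circ> inv f permutes UNIV" if "p permutes UNIV" for p
      using that assms
      by (intro bij_imp_permutes bij_comp) (auto simp: bij_imp_bij_inv permutes_bij)
    then show "(\<lambda>p. f \<circ> p \<circ> inv f) \<in> {p. p permutes UNIV} \<rightarrow> {p. p permutes UNIV}" by auto
    have "inv f \<circ> p \<circ> f permutes UNIV" if "p permutes UNIV" for p
      using that assms
      by (intro bij_imp_permutes bij_comp) (auto simp: bij_imp_bij_inv permutes_bij)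
    then show "(\<lambda>q. inv f \<circ> q \<circ> f) \<in> {p. p permutes UNIV} \<rightarrow> {p. p permutes UNIV}" by auto
  qed (auto simp: fun_eq_iff bij_is_inj bij_is_surj surj_f_inv_f)
  have "det A = (\<Sum>p | p permutes UNIV. of_int (sign (f \<circ> p \<circ> inv f))
          * (\<Prod>i\<in>UNIV. A $ i $ (f \<circ> p \<circ> inv f) i))"
    unfolding det_def by (subst sum.reindex_bij_betw[OF b, symmetric]) simp
  also have "\<dots> = (\<Sum>p | p permutes UNIV. of_int (sign p) * (\<Prod>i\<in>UNIV. A $ f i $ f (p i)))"
    using assms
    by (intro sum.cong refl arg_cong2[of _ _ _ _ "(*)"])
      (auto simp: sign_conj_bij bij_is_inj prod.reindex_bij_betw[OF assms, symmetric])
  finally show ?thesis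
    by (simp add: det_def)
qed

text \<open>Lebesgue measure is determined by its values on boxes, and the preimage of a box under
  relabelling is a box with the same side lengths in another order.\<close>

lemma lborel_distr_reindex:
  fixes f :: "'m::finite \<Rightarrow> 'n::finite"
  assumes "bij f"
  shows "distr lborel borel (\<lambda>x::real^'n. \<chi> i. x $ f i) = (lborel :: (real^'m) measure)"
proof (rule lborel_eqI[symmetric])
  let ?J = "\<lambda>x::real^'n. (\<chi> i. x $ f i) :: real^'m"
  have [measurable]: "?J \<in> borel_measurable borel"
    by (intro borel_measurable_continuous_onI continuous_intros)
  fix l u :: "real^'m" assume lu: "\<And>b. b \<in> Basis \<Longrightarrow> l \<bullet> b \<le> u \<bullet> b"
  have lu': "l $ i \<le> u $ i" for i using lu[of "axis i 1"] by (simp add: inner_axis axis_in_Basis_iff)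
  let ?l = "(\<chi> j. l $ inv f j) :: real^'n" and ?u = "(\<chi> j. u $ inv f j) :: real^'n"
  have "?J -` box l u = box ?l ?u"
    using assms by (auto simp: mem_box_cart) (metis assms bij_inv_eq_iff)+
  moreover have "prod (\<lambda>b. (?u - ?l) \<bullet> b) Basis = prod (\<lambda>b. (u - l) \<bullet> b) Basis"
  proof -
    have 1: "prod (\<lambda>b. x \<bullet> b) Basis = prod (\<lambda>i. x $ i) UNIV" for x :: "real^'k::finite"
    proof -
      have "Basis = (\<lambda>i. axis i 1 :: real^'k) ` UNIV" by (auto simp: Basis_vec_def)
      moreover have "inj (\<lambda>i. axis i 1 :: real^'k)" by (auto simp: inj_on_def axis_eq_axis)
      ultimately have "prod (\<lambda>b. x \<bullet> b) Basis = prod (\<lambda>i. x \<bullet> axis i 1) UNIV"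
        by (intro prod.reindex_cong) auto
      then show ?thesis by (simp add: inner_axis)
    qed
    have "bij (inv f)" using assms by (rule bij_imp_bij_inv)
    show ?thesis unfolding 1
      by (subst prod.reindex_bij_betw[OF \<open>bij (inv f)\<close>, symmetric]) simp
  qed
  ultimately show "emeasure (distr lborel borel ?J) (box l u) = (\<Prod>b\<in>Basis. (u - l) \<bullet> b)"
    using lu' by (subst emeasure_distr) (auto simp: emeasure_lborel_box_eq Basis_vec_def inner_axis)
qed simp

text \<open>The preimage of a box under \<open>f\<close> is its image under the inverse
  \<open>g\<close>, so the volume formula for images applies to \<open>g\<close>; the density
  cancels its factor because the two determinants multiply to 1.\<close>

lemma lborel_linear_wellorder:
  fixes f :: "real^'n::{finite,wellorder} \<Rightarrow> real^'n::_"
  assumes "linear f" "det (matrix f) \<noteq> 0"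
  shows "lborel = density (distr lborel borel f) (\<lambda>_. \<bar>det (matrix f)\<bar>)"
proof (rule lborel_eqI)
  have "inj f" using assms det_nz_iff_inj by blast
  then obtain g where g: "linear g" "g \<circ> f = id"
    using assms(1) linear_injective_left_inverse by blast
  then have fg: "f \<circ> g = id" using linear_inverse_left[OF assms(1)] by blast
  have [measurable]: "f \<in> borel_measurable borel"
    using assms(1) by (simp add: borel_measurable_continuous_onI linear_continuous_on linear_linear)
  have d: "det (matrix f) * det (matrix g) = 1"
    using matrix_compose[OF g(1) assms(1)] fg by (metis det_mul matrix_id)
  fix l u :: "real^'n::_" assume lu: "\<And>b. b \<in> Basis \<Longrightarrow> l \<bullet> b \<le> u \<bullet> b"
  have vim: "f -` box l u = g ` box l u"
    using g(2) fg by (auto simp: fun_eq_iff image_iff intro!: bexI[of _ "f _"]) 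
  have m: "measure lebesgue (g ` box l u) = \<bar>det (matrix g)\<bar> * measure lebesgue (box l u)"
      "g ` box l u \<in> lmeasurable"
    using measure_linear_image[OF g(1)] measurable_linear_image[OF g(1)] by auto
  have "f -` box l u \<in> sets borel"
    using measurable_sets_borel[OF \<open>f \<in> borel_measurable borel\<close>] by simp
  then have "emeasure lborel (f -` box l u) = emeasure lebesgue (f -` box l u)" by simp
  also have "\<dots> = ennreal (\<bar>det (matrix g)\<bar> * measure lebesgue (box l u))"
    using m unfolding vim by (simp add: emeasure_eq_measure2 fmeasurableD2)
  finally have "emeasure lborel (f -` box l u) = ennreal (\<bar>det (matrix g)\<bar> * measure lebesgue (box l u))" .
  moreover have "\<bar>det (matrix f)\<bar> * \<bar>det (matrix g)\<bar> = 1" using d by (metis abs_1 abs_mult)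
  ultimately show "emeasure (density (distr lborel borel f) (\<lambda>_. ennreal \<bar>det (matrix f)\<bar>)) (box l u) =
         (\<Prod>b\<in>Basis. (u - l) \<bullet> b)"
    using lu by (auto simp: emeasure_density nn_integral_cmult_indicator emeasure_distr
        ennreal_mult'[symmetric] mult.assoc[symmetric] measure_lborel_box)
qed simp

lemma nn_integral_lborel_linear:
  fixes f :: "real^'n::finite \<Rightarrow> real^'n"
  assumes f: "linear f" "det (matrix f) \<noteq> 0" and [measurable]: "h \<in> borel_measurable borel"
  shows "(\<integral>\<^sup>+x. h x \<partial>lborel) = \<bar>det (matrix f)\<bar> * (\<integral>\<^sup>+x. h (f x) \<partial>lborel)"
proof -
  let ?r = "Rep_wellordered_copy :: 'n wellordered_copy \<Rightarrow> 'n"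
  let ?J = "\<lambda>x::real^'n. (\<chi> i. x $ ?r i) :: real^'n wellordered_copy"
  let ?I = "\<lambda>y::real^'n wellordered_copy. (\<chi> i. y $ inv ?r i) :: real^'n"
  note b = bij_Rep_wellordered_copy[where 'n='n]
  have [simp]: "?r (inv ?r i) = i" for i using b by (simp add: bij_is_surj surj_f_inv_f)
  have [measurable]: "?J \<in> borel_measurable borel" "?I \<in> borel_measurable borel"
    by (intro borel_measurable_continuous_onI continuous_intros)+
  have [measurable]: "f \<in> borel_measurable borel"
    using f(1) by (simp add: borel_measurable_continuous_onI linear_continuous_on linear_linear)
  have J: "(\<integral>\<^sup>+x. k (?J x) \<partial>lborel) = (\<integral>\<^sup>+y. k y \<partial>lborel)" if "k \<in> borel_measurable borel" for k
  proof -
    have "(\<integral>\<^sup>+y. k y \<partial>lborel) = (\<integral>\<^sup>+y. k y \<partial>distr lborel borel ?J)"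
      by (simp add: lborel_distr_reindex[OF b])
    then show ?thesis using that by (simp add: nn_integral_distr)
  qed
  \<comment> \<open>\<open>F\<close> is \<open>f\<close> transported to the ordered copy; its matrix
    is that of \<open>f\<close> with relabelled rows and columns, so the determinant is
    unchanged.\<close>
  define F where "F y = ?J (f (?I y))" for y
  have lin: "linear F"
  proof -
    have "linear ?I" "linear ?J" by (auto intro!: linearI simp: vec_eq_iff)
    then show ?thesis
      using linear_compose[OF linear_compose[OF \<open>linear ?I\<close> f(1)] \<open>linear ?J\<close>]
      by (simp add: F_def[abs_def] o_def)
  qed
  have "?I (axis j 1) = axis (?r j) 1" for j
    using b by (auto simp: vec_eq_iff axis_def bij_is_inj bij_is_surj surj_f_inv_f)
  then have "matrix F = (\<chi> i j. matrix f $ ?r i $ ?r j)"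
    by (simp add: matrix_def F_def vec_eq_iff)
  then have det: "det (matrix F) = det (matrix f)"
    by (simp add: det_reindex[OF b])
  have [measurable]: "F \<in> borel_measurable borel"
    unfolding F_def by measurable
  have "(\<integral>\<^sup>+x. h x \<partial>lborel) = (\<integral>\<^sup>+y. h (?I y) \<partial>lborel)"
    by (subst J[symmetric]) simp_all
  also have "\<dots> = \<bar>det (matrix f)\<bar> * (\<integral>\<^sup>+y. h (?I (F y)) \<partial>lborel)"
    using f(2) det
    by (subst lborel_linear_wellorder[OF lin]) (simp_all add: nn_integral_density nn_integral_distr nn_integral_cmult)
  also have "(\<integral>\<^sup>+y. h (?I (F y)) \<partial>lborel) = (\<integral>\<^sup>+x. h (f x) \<partial>lborel)"
    by (subst J[symmetric]) (simp_all add: F_def)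
  finally show ?thesis .
qed

section \<open>Linear images of the surface measure\<close>

text \<open>This and the next integral are the two radial integrals in
  \<open>nn_integral_cone_gauge\<close>, used with \<open>b = 1 / r x\<close> and
  \<open>a = norm x\<close>. Endpoints are null sets, which gives access to the fundamental theorem
  on closed intervals.\<close>

lemma nn_integral_power_interval:
  fixes b :: real
  assumes "0 < b" "0 < n"
  shows "(\<integral>\<^sup>+s. ennreal (n * s ^ (n - 1)) * indicator {0<..<b} s \<partial>lborel) = ennreal (b ^ n)"
proof -
  have "(\<integral>\<^sup>+s. ennreal (n * s ^ (n - 1)) * indicator {0<..<b} s \<partial>lborel)
      = (\<integral>\<^sup>+s. ennreal (n * s ^ (n - 1)) * indicator {0..b} s \<partial>lborel)"
    using AE_lborel_singleton[of 0] AE_lborel_singleton[of b]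
    by (intro nn_integral_cong_AE, eventually_elim) (auto split: split_indicator)
  also have "\<dots> = ennreal (b ^ n - 0 ^ n)"
    using assms by (intro nn_integral_FTC_Icc[where F = "\<lambda>s. s ^ n"]) (auto intro!: derivative_eq_intros)
  finally show ?thesis using assms by simp
qed

lemma nn_integral_inverse_power_tail:
  fixes a :: real
  assumes "0 < a" "0 < n"
  shows "(\<integral>\<^sup>+s. ennreal (n / s ^ (n + 1)) * indicator {a<..} s \<partial>lborel) = ennreal (1 / a ^ n)"
proof -
  have "(\<integral>\<^sup>+s. ennreal (n / s ^ (n + 1)) * indicator {a<..} s \<partial>lborel)
      = (\<integral>\<^sup>+s. ennreal (n / s ^ (n + 1)) * indicator {a..} s \<partial>lborel)"
    using AE_lborel_singleton[of a]
    by (intro nn_integral_cong_AE, eventually_elim) (auto split: split_indicator)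
  also have "\<dots> = ennreal (0 - - (1 / a ^ n))"
  proof (intro nn_integral_FTC_atLeast[where F = "\<lambda>s. - (1 / s ^ n)"])
    fix s assume "a \<le> s"
    then have s: "s > 0" using assms by simp
    have "s ^ n = s * s ^ (n - 1)" using assms by (simp flip: power_Suc)
    then show "((\<lambda>s. - (1 / s ^ n)) has_real_derivative n / s ^ (n + 1)) (at s)"
      using s by (auto intro!: derivative_eq_intros simp: field_simps power2_eq_square)
    show "0 \<le> n / s ^ (n + 1)" using s by simp
  next
    have "((\<lambda>s::real. inverse (s ^ n)) \<longlongrightarrow> 0) at_top"
      using assms by (intro tendsto_inverse_0_at_top filterlim_pow_at_top filterlim_ident) auto
    then show "((\<lambda>s::real. - (1 / s ^ n)) \<longlongrightarrow> 0) at_top"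
      using tendsto_minus by (fastforce simp: divide_inverse)
  qed measurable
  finally show ?thesis by simp
qed

lemma nn_integral_lborel_scale:
  fixes h :: "real^'n::finite \<Rightarrow> ennreal"
  assumes "0 < s" and [measurable]: "h \<in> borel_measurable borel"
  shows "(\<integral>\<^sup>+x. h x \<partial>lborel) = ennreal (s ^ CARD('n)) * (\<integral>\<^sup>+x. h (s *\<^sub>R x) \<partial>lborel)"
  using assms(1)
  by (subst lborel_affine[of s 0])
    (simp_all add: nn_integral_density nn_integral_distr nn_integral_cmult)

text \<open>Changing the gauge of a cone measure from the Euclidean norm to \<open>r\<close>.  Both sides are the two
  ways of integrating the kernel \<open>k\<close> below over \<open>(x, s)\<close>: directly in \<open>s\<close>, or after
  substituting \<open>x / s\<close> for \<open>x\<close>.\<close>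

lemma nn_integral_cone_gauge:
  fixes \<phi> :: "real^'n::finite \<Rightarrow> ennreal" and r :: "real^'n \<Rightarrow> real"
  assumes [measurable]: "\<phi> \<in> borel_measurable borel" "r \<in> borel_measurable borel"
    and \<phi>: "\<And>s x. 0 < s \<Longrightarrow> \<phi> (s *\<^sub>R x) = \<phi> x"
    and r: "\<And>s x. 0 < s \<Longrightarrow> r (s *\<^sub>R x) = s * r x" and r_pos: "\<And>x. x \<noteq> 0 \<Longrightarrow> 0 < r x"
  shows "(\<integral>\<^sup>+x. \<phi> x * ennreal ((norm x / r x) ^ CARD('n)) * indicator (ball 0 1) x \<partial>lborel)
    = (\<integral>\<^sup>+x. \<phi> x * indicator {x. r x < 1} x \<partial>lborel)"
proof -
  let ?n = "CARD('n)"
  have n: "0 < ?n" by simp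
  \<comment> \<open>The factor n s^(n-1) integrates over 0 < s < 1 / r x to 1 / (r x)^n, which
    together with (norm x)^n is the weight on the left-hand side.\<close>
  define k where "k x s = \<phi> x * ennreal (?n * norm x ^ ?n * s ^ (?n - 1))
      * indicator {x. norm x < 1} x * indicator {(x, s). 0 < s \<and> s * r x < 1} (x, s)" for x s
  \<comment> \<open>For s > 0 this is s^(-n) k (x / s) s. The Jacobian and the norm of x / s
    contribute s^(-n) each and turn s^(n-1) into 1 / s^(n+1). The constraints exchange roles: s * r
    (x / s) < 1 becomes r x < 1, and norm (x / s) < 1 becomes norm x < s.\<close>
  define k' where "k' x s = \<phi> x * ennreal (norm x ^ ?n * (?n / s ^ (?n + 1)))
      * indicator {x. r x < 1} x * indicator {(x, s). norm x < s} (x, s)" for x :: "real^'n" and s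
  have [measurable]: "case_prod k \<in> borel_measurable (borel \<Otimes>\<^sub>M borel)"
    "case_prod k' \<in> borel_measurable (borel \<Otimes>\<^sub>M borel)"
    unfolding k_def k'_def by measurable
  have [measurable]: "k x \<in> borel_measurable borel" "k' x \<in> borel_measurable borel"
    "(\<lambda>x. k x s) \<in> borel_measurable borel" for x s
    by measurable
  have AE0: "AE x in lborel. x \<noteq> (0::real^'n)" by (rule AE_lborel_singleton)
  have "(\<integral>\<^sup>+x. \<phi> x * ennreal ((norm x / r x) ^ ?n) * indicator (ball 0 1) x \<partial>lborel)
      = (\<integral>\<^sup>+x. \<integral>\<^sup>+s. k x s \<partial>lborel \<partial>lborel)"
  proof (intro nn_integral_cong_AE, use AE0 in eventually_elim)
    case (elim x)
    have "k x s = (\<phi> x * ennreal (norm x ^ ?n) * indicator (ball 0 1) x)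
        * (ennreal (?n * s ^ (?n - 1)) * indicator {0<..<1 / r x} s)" for s :: real
      using r_pos[OF elim]
      by (auto simp: k_def field_simps ennreal_mult'[symmetric] split: split_indicator)
    then have "(\<integral>\<^sup>+s. k x s \<partial>lborel)
        = (\<phi> x * ennreal (norm x ^ ?n) * indicator (ball 0 1) x) * ennreal ((1 / r x) ^ ?n)"
      using r_pos[OF elim] nn_integral_power_interval[of "1 / r x" ?n]
      by (simp add: nn_integral_cmult)
    moreover have "ennreal ((norm x / r x) ^ ?n) = ennreal (norm x ^ ?n) * ennreal ((1 / r x) ^ ?n)"
      using r_pos[OF elim] by (simp add: power_divide flip: ennreal_mult')
    ultimately show ?case
      by (simp add: mult_ac)
  qed
  also have "\<dots> = (\<integral>\<^sup>+s. \<integral>\<^sup>+x. k x s \<partial>lborel \<partial>lborel)"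
    by (rule lborel_pair.Fubini'[symmetric]) simp
  also have "\<dots> = (\<integral>\<^sup>+s. \<integral>\<^sup>+x. k' x s \<partial>lborel \<partial>lborel)"
  proof (rule nn_integral_cong)
    fix s :: real
    show "(\<integral>\<^sup>+x. k x s \<partial>lborel) = (\<integral>\<^sup>+x. k' x s \<partial>lborel)"
    proof (cases "0 < s")
      case True
      then have "(\<integral>\<^sup>+x. k x s \<partial>lborel) = ennreal ((1 / s) ^ ?n) * (\<integral>\<^sup>+x. k ((1 / s) *\<^sub>R x) s \<partial>lborel)"
        by (intro nn_integral_lborel_scale) auto
      also have "\<dots> = (\<integral>\<^sup>+x. ennreal ((1 / s) ^ ?n) * k ((1 / s) *\<^sub>R x) s \<partial>lborel)"
        by (rule nn_integral_cmult[symmetric]) measurable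
      also have "\<dots> = (\<integral>\<^sup>+x. k' x s \<partial>lborel)"
      proof (intro nn_integral_cong)
        fix x :: "real^'n"
        have "s ^ ?n = s * s ^ (?n - 1)" using n by (simp flip: power_Suc)
        then have "(1 / s) ^ ?n * (?n * norm ((1 / s) *\<^sub>R x) ^ ?n * s ^ (?n - 1))
            = norm x ^ ?n * (?n / s ^ (?n + 1))"
          using True by (simp add: field_simps)
        then have "ennreal ((1 / s) ^ ?n) * ennreal (?n * norm ((1 / s) *\<^sub>R x) ^ ?n * s ^ (?n - 1))
            = ennreal (norm x ^ ?n * (?n / s ^ (?n + 1)))"
          using True by (subst ennreal_mult'[symmetric]) auto
        then show "ennreal ((1 / s) ^ ?n) * k ((1 / s) *\<^sub>R x) s = k' x s"
          using True \<phi>[of "1 / s" x] r[of "1 / s" x]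
          by (auto simp: k_def k'_def mult_ac split: split_indicator)
      qed
      finally show ?thesis .
    next
      case False
      have "\<not> norm x < s" for x :: "real^'n" using False norm_ge_zero[of x] by linarith
      then show ?thesis using False by (simp add: k_def k'_def)
    qed
  qed
  also have "\<dots> = (\<integral>\<^sup>+x. \<integral>\<^sup>+s. k' x s \<partial>lborel \<partial>lborel)"
    by (rule lborel_pair.Fubini') simp
  also have "\<dots> = (\<integral>\<^sup>+x. \<phi> x * indicator {x. r x < 1} x \<partial>lborel)"
  proof (intro nn_integral_cong_AE, use AE0 in eventually_elim)
    case (elim x)
    have "k' x s = (\<phi> x * ennreal (norm x ^ ?n) * indicator {x. r x < 1} x)
        * (ennreal (?n / s ^ (?n + 1)) * indicator {norm x<..} s)" for s :: real
    proof -
      have "ennreal (norm x ^ ?n * (?n / s ^ (?n + 1)))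
          = ennreal (norm x ^ ?n) * ennreal (?n / s ^ (?n + 1))"
        by (rule ennreal_mult') simp
      then show ?thesis
        unfolding k'_def by (simp split: split_indicator add: mult_ac)
    qed
    then have "(\<integral>\<^sup>+s. k' x s \<partial>lborel)
        = (\<phi> x * ennreal (norm x ^ ?n) * indicator {x. r x < 1} x) * ennreal (1 / norm x ^ ?n)"
      using elim nn_integral_inverse_power_tail[of "norm x" ?n]
      by (simp add: nn_integral_cmult)
    also have "\<dots> = \<phi> x * indicator {x. r x < 1} x * (ennreal (norm x ^ ?n) * ennreal (1 / norm x ^ ?n))"
      by (simp only: mult_ac)
    also have "ennreal (norm x ^ ?n) * ennreal (1 / norm x ^ ?n) = 1"
      using elim by (simp flip: ennreal_mult')
    finally show ?case
      by simp
  qed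
  finally show ?thesis .
qed

section \<open>Integration against the cone form of the surface measure\<close>

lemma space_sphere_measure [simp]: "space (sphere_measure :: (real^'n::finite) measure) = sphere 0 1"
  by (simp add: sphere_measure_def space_restrict_space space_scale_measure)

lemma sets_sphere_measure [simp, measurable_cong]:
  "sets (sphere_measure :: (real^'n::finite) measure) = sets (restrict_space borel (sphere 0 1))"
  by (simp add: sphere_measure_def)

lemma borel_measurable_sphere_measure:
  "f \<in> borel_measurable borel \<Longrightarrow> f \<in> borel_measurable (sphere_measure :: (real^'n::finite) measure)"
  by (simp add: measurable_restrict_space1 cong: measurable_cong_sets)

lemma normalize_measurable:
  "(\<lambda>x::real^'n::finite. x /\<^sub>R norm x)
     \<in> restrict_space borel (- {0}) \<rightarrow>\<^sub>M restrict_space borel (sphere 0 1)"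
  by (rule measurable_restrict_space2)
    (auto simp: space_restrict_space intro!: borel_measurable_continuous_on_restrict continuous_intros)

text \<open>The measure comes from the punctured ball. Measurability constrains \<open>f\<close> on
  the sphere only, so the meaningless direction of the origin is given the value 0 to obtain an
  integrand on the whole space.\<close>

lemma nn_integral_sphere_measure:
  fixes f :: "real^'n::finite \<Rightarrow> ennreal"
  assumes f: "f \<in> borel_measurable sphere_measure"
  shows "(\<integral>\<^sup>+u. f u \<partial>sphere_measure)
    = of_nat CARD('n) * (\<integral>\<^sup>+x. (if x = 0 then 0 else f (x /\<^sub>R norm x)) * indicator (ball 0 1) x \<partial>lborel)"
proof -
  have f': "f \<in> borel_measurable (restrict_space borel (sphere 0 1))"
    using f by simp
  have N: "(\<lambda>x::real^'n::finite. x /\<^sub>R norm x)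
     \<in> restrict_space lborel (ball 0 1 - {0}) \<rightarrow>\<^sub>M restrict_space borel (sphere 0 1)"
    by (rule measurable_restrict_space2)
     (auto simp: space_restrict_space intro!: borel_measurable_continuous_on_restrict continuous_intros
       cong: measurable_cong_sets sets_restrict_space_cong)
  have "(\<integral>\<^sup>+u. f u \<partial>sphere_measure)
      = of_nat CARD('n) * (\<integral>\<^sup>+x. f (x /\<^sub>R norm x) \<partial>restrict_space lborel (ball 0 1 - {0}))"
    unfolding sphere_measure_def using f' N
    by (simp add: nn_integral_scale_measure nn_integral_distr)
  also have "(\<integral>\<^sup>+x. f (x /\<^sub>R norm x) \<partial>restrict_space lborel (ball 0 1 - {0}))
      = (\<integral>\<^sup>+x. (if x = 0 then 0 else f (x /\<^sub>R norm x)) * indicator (ball 0 1) x \<partial>lborel)"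
    by (subst nn_integral_restrict_space) (auto intro!: nn_integral_cong split: split_indicator)
  finally show ?thesis .
qed

lemma spherical_image_measurable:
  fixes A :: "real^'n::finite \<Rightarrow> real^'n"
  assumes "linear A" "inj A"
  shows "(\<lambda>x. A x /\<^sub>R norm (A x)) \<in> sphere_measure \<rightarrow>\<^sub>M sphere_measure"
proof -
  have nz: "A x \<noteq> 0" if "norm x = 1" for x
    using that assms linear_injective_0 by (metis norm_zero zero_neq_one)
  have "continuous_on S A" for S
    using assms(1) by (simp add: linear_continuous_on linear_linear)
  then have "(\<lambda>x. A x /\<^sub>R norm (A x)) \<in> restrict_space borel (sphere 0 1) \<rightarrow>\<^sub>M restrict_space borel (sphere 0 1)"
    using nz by (intro measurable_restrict_space2)
      (auto simp: space_restrict_space intro!: borel_measurable_continuous_on_restrict continuous_intros)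
  then show ?thesis
    by (simp cong: measurable_cong_sets)
qed

text \<open>In cone form the weight at x becomes (norm x / norm (A x))^n. By
  \<open>nn_integral_cone_gauge\<close> with gauge \<open>norm (A x)\<close> this weight trades the
  unit ball for the ellipsoid norm (A x) < 1, and the linear substitution y = A x maps the ellipsoid
  back to the ball at the cost of the determinant.\<close>

lemma nn_integral_spherical_image:
  fixes A :: "real^'n::finite \<Rightarrow> real^'n" and f :: "real^'n \<Rightarrow> ennreal"
  assumes A: "linear A" "inj A" and f: "f \<in> borel_measurable sphere_measure"
  shows "(\<integral>\<^sup>+u. ennreal (1 / norm (A u) ^ CARD('n)) * f (A u /\<^sub>R norm (A u)) \<partial>sphere_measure)
    = ennreal (1 / \<bar>det (matrix A)\<bar>) * (\<integral>\<^sup>+u. f u \<partial>sphere_measure)"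
proof -
  let ?n = "CARD('n)"
  have nz: "A x = 0 \<longleftrightarrow> x = 0" for x
    using linear_injective_0[OF A(1)] A(2) linear_0[OF A(1)] by auto
  have [measurable]: "A \<in> borel_measurable borel"
    using A(1) by (simp add: borel_measurable_continuous_onI linear_continuous_on linear_linear)
  have d: "det (matrix A) \<noteq> 0" using A det_nz_iff_inj by blast
  define g where "g x = (if x = 0 then 0 else f (x /\<^sub>R norm x))" for x
  have f': "f \<in> borel_measurable (restrict_space borel (sphere 0 1))"
    using f by simp
  have [measurable]: "g \<in> borel_measurable borel"
    unfolding g_def using measurable_compose[OF normalize_measurable f']
    by (subst measurable_If_restrict_space_iff) (auto simp: Compl_eq)
  have w: "(\<lambda>u. ennreal (1 / norm (A u) ^ ?n)) \<in> borel_measurable sphere_measure"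
    by (rule borel_measurable_sphere_measure) measurable
  have "(\<integral>\<^sup>+u. ennreal (1 / norm (A u) ^ ?n) * f (A u /\<^sub>R norm (A u)) \<partial>sphere_measure)
    = of_nat ?n * (\<integral>\<^sup>+x. g (A x) * ennreal ((norm x / norm (A x)) ^ ?n) * indicator (ball 0 1) x \<partial>lborel)"
  proof -
    have pointwise: "(if x = 0 then 0 else ennreal (1 / norm (A (x /\<^sub>R norm x)) ^ ?n)
          * f (A (x /\<^sub>R norm x) /\<^sub>R norm (A (x /\<^sub>R norm x))))
        = g (A x) * ennreal ((norm x / norm (A x)) ^ ?n)" for x
    proof (cases "x = 0")
      case False
      then have "A x \<noteq> 0" using nz by simp
      have e: "1 / norm (A (x /\<^sub>R norm x)) = norm x / norm (A x)"
        using False by (simp add: linear_cmul[OF A(1)] field_simps)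
      have "1 / norm (A (x /\<^sub>R norm x)) ^ ?n = (norm x / norm (A x)) ^ ?n"
        unfolding e[symmetric] by (rule power_one_over[symmetric])
      moreover have "A (x /\<^sub>R norm x) /\<^sub>R norm (A (x /\<^sub>R norm x)) = A x /\<^sub>R norm (A x)"
        using False by (simp add: linear_cmul[OF A(1)])
      ultimately show ?thesis
        using False \<open>A x \<noteq> 0\<close> by (simp only: g_def if_False mult.commute)
    qed (simp add: g_def linear_0[OF A(1)])
    have "(\<lambda>u. ennreal (1 / norm (A u) ^ ?n) * f (A u /\<^sub>R norm (A u)))
        \<in> borel_measurable sphere_measure"
      using measurable_compose[OF spherical_image_measurable[OF A] f] w by (intro borel_measurable_times_ennreal)
    then show ?thesis
      by (simp only: nn_integral_sphere_measure pointwise)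
  qed
  also have "(\<integral>\<^sup>+x. g (A x) * ennreal ((norm x / norm (A x)) ^ ?n) * indicator (ball 0 1) x \<partial>lborel)
    = (\<integral>\<^sup>+x. g (A x) * indicator {x. norm (A x) < 1} x \<partial>lborel)"
  proof (rule nn_integral_cone_gauge)
    show "g (A (s *\<^sub>R x)) = g (A x)" if "0 < s" for s x
    proof -
      have "A (s *\<^sub>R x) /\<^sub>R norm (A (s *\<^sub>R x)) = A x /\<^sub>R norm (A x)"
        using that by (simp add: linear_cmul[OF A(1)] mult.commute[of _ s] mult.left_commute)
      moreover have "A (s *\<^sub>R x) = 0 \<longleftrightarrow> A x = 0"
        using that nz by simp
      ultimately show ?thesis
        by (simp only: g_def)
    qed
  qed (simp_all add: linear_cmul[OF A(1)] nz)
  also have "\<dots> = (\<integral>\<^sup>+x. g (A x) * indicator (ball 0 1) (A x) \<partial>lborel)"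
    by (auto intro!: nn_integral_cong split: split_indicator)
  also have "\<dots> = ennreal (1 / \<bar>det (matrix A)\<bar>) * (\<integral>\<^sup>+y. g y * indicator (ball 0 1) y \<partial>lborel)"
  proof -
    have "ennreal (1 / \<bar>det (matrix A)\<bar>) * ennreal \<bar>det (matrix A)\<bar> = 1"
      using d by (simp flip: ennreal_mult')
    moreover have "(\<lambda>y. g y * indicator (ball 0 1) y) \<in> borel_measurable borel"
      by (intro borel_measurable_times_ennreal borel_measurable_indicator) auto
    note nn_integral_lborel_linear[OF A(1) d this]
    ultimately show ?thesis
      by (simp add: mult.assoc[symmetric])
  qed
  finally show ?thesis
    by (subst nn_integral_sphere_measure[OF f]) (simp add: g_def mult_ac)
qed

text \<open>For measurable \<open>f\<close> this is a density and a push-forward. For other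
  \<open>f\<close> the integrand on the left is not measurable either, so both integrals take the
  default value 0.\<close>

lemma integral_spherical_image:
  fixes A :: "real^'n::finite \<Rightarrow> real^'n" and f :: "real^'n \<Rightarrow> real"
  assumes A: "linear A" "inj A"
  shows "(LINT u|sphere_measure. f (A u /\<^sub>R norm (A u)) / norm (A u) ^ CARD('n))
    = (LINT u|sphere_measure. f u) / \<bar>det (matrix A)\<bar>"
proof -
  let ?n = "CARD('n)" and ?\<sigma> = "sphere_measure :: (real^'n) measure"
  let ?G = "\<lambda>u. A u /\<^sub>R norm (A u)"
  have nz: "A x = 0 \<longleftrightarrow> x = 0" for x
    using linear_injective_0[OF A(1)] A(2) linear_0[OF A(1)] by auto
  have d: "det (matrix A) \<noteq> 0" using A det_nz_iff_inj by blast
  note G[measurable] = spherical_image_measurable[OF A]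
  have [measurable]: "A \<in> borel_measurable borel"
    using A(1) by (simp add: borel_measurable_continuous_onI linear_continuous_on linear_linear)
  have w[measurable]: "(\<lambda>u. 1 / norm (A u) ^ ?n) \<in> borel_measurable ?\<sigma>"
    "(\<lambda>u. norm (A u) ^ ?n) \<in> borel_measurable ?\<sigma>"
    by (rule borel_measurable_sphere_measure; measurable)+
  \<comment> \<open>The nonnegative formula on indicators, packaged as an identity of measures so
    that it applies to Bochner integrals.\<close>
  have eq: "distr (density ?\<sigma> (\<lambda>u. ennreal (1 / norm (A u) ^ ?n))) ?\<sigma> ?G
      = scale_measure (ennreal (1 / \<bar>det (matrix A)\<bar>)) ?\<sigma>"
  proof (rule measure_eqI)
    fix E assume "E \<in> sets (distr (density ?\<sigma> (\<lambda>u. ennreal (1 / norm (A u) ^ ?n))) ?\<sigma> ?G)"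
    then have E[measurable]: "E \<in> sets ?\<sigma>" by simp
    have "emeasure (distr (density ?\<sigma> (\<lambda>u. ennreal (1 / norm (A u) ^ ?n))) ?\<sigma> ?G) E
        = (\<integral>\<^sup>+u. ennreal (1 / norm (A u) ^ ?n) * indicator E (?G u) \<partial>?\<sigma>)"
    proof -
      have "?G \<in> density ?\<sigma> (\<lambda>u. ennreal (1 / norm (A u) ^ ?n)) \<rightarrow>\<^sub>M ?\<sigma>"
        using G by (simp cong: measurable_cong_sets)
      then show ?thesis
        using measurable_sets[OF G E] E
        by (subst emeasure_distr)
          (auto simp: emeasure_density intro!: nn_integral_cong split: split_indicator)
    qed
    also have "\<dots> = ennreal (1 / \<bar>det (matrix A)\<bar>) * (\<integral>\<^sup>+u. indicator E u \<partial>?\<sigma>)"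
      by (rule nn_integral_spherical_image[OF A]) simp
    finally show "emeasure (distr (density ?\<sigma> (\<lambda>u. ennreal (1 / norm (A u) ^ ?n))) ?\<sigma> ?G) E
        = emeasure (scale_measure (ennreal (1 / \<bar>det (matrix A)\<bar>)) ?\<sigma>) E"
      by (simp only: nn_integral_indicator[OF E] emeasure_scale_measure)
  qed simp
  show ?thesis
  proof (cases "f \<in> borel_measurable ?\<sigma>")
    case True
    then have [measurable]: "f \<in> borel_measurable ?\<sigma>" .
    have "(LINT u|?\<sigma>. f (?G u) / norm (A u) ^ ?n)
        = (LINT u|density ?\<sigma> (\<lambda>u. ennreal (1 / norm (A u) ^ ?n)). f (?G u))"
      by (subst integral_density) auto
    also have "\<dots> = (LINT v|distr (density ?\<sigma> (\<lambda>u. ennreal (1 / norm (A u) ^ ?n))) ?\<sigma> ?G. f v)"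
      by (rule integral_distr[symmetric]) auto
    also have "\<dots> = (LINT v|?\<sigma>. f v) / \<bar>det (matrix A)\<bar>"
    proof -
      have "scale_measure (ennreal c) ?\<sigma> = density ?\<sigma> (\<lambda>_. ennreal c)" for c
        by (rule measure_eqI) (simp_all add: emeasure_density_const)
      then show ?thesis
        unfolding eq by (simp add: integral_density)
    qed
    finally show ?thesis .
  next
    case False
    obtain B where B: "linear B" "B \<circ> A = id"
      using A linear_injective_left_inverse by blast
    then have AB: "A \<circ> B = id" using linear_inverse_left[OF A(1)] by blast
    then have "inj B" by (auto simp: fun_eq_iff intro: inj_on_inverseI[of _ A])
    note H[measurable] = spherical_image_measurable[OF B(1) \<open>inj B\<close>]
    \<comment> \<open>Multiplying by norm (A u)^n and composing with the normalised inverse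
      \<open>B\<close> recovers \<open>f\<close> on the sphere.\<close>
    have "f \<in> borel_measurable ?\<sigma>" if "(\<lambda>u. f (?G u) / norm (A u) ^ ?n) \<in> borel_measurable ?\<sigma>"
    proof -
      have "(\<lambda>u. f (?G u) / norm (A u) ^ ?n * norm (A u) ^ ?n) \<in> borel_measurable ?\<sigma>"
        using that w(2) by (rule borel_measurable_times)
      from measurable_compose[OF H this]
      show ?thesis
      proof (rule measurable_cong[THEN iffD1, rotated])
        fix v :: "real^'n" assume "v \<in> space ?\<sigma>"
        then have v: "norm v = 1" by simp
        have ABv: "A (B v) = v" using AB by (simp add: fun_eq_iff)
        then have "B v \<noteq> 0" using v linear_0[OF A(1)] by fastforce
        then have c: "A (B v /\<^sub>R norm (B v)) = v /\<^sub>R norm (B v)" "norm (B v) \<noteq> 0"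
          using ABv by (simp_all add: linear_cmul[OF A(1)])
        show "f (?G (B v /\<^sub>R norm (B v))) / norm (A (B v /\<^sub>R norm (B v))) ^ ?n
            * norm (A (B v /\<^sub>R norm (B v))) ^ ?n = f v"
          unfolding c using c(2) v by simp
      qed
    qed
    then have "\<not> integrable ?\<sigma> (\<lambda>u. f (?G u) / norm (A u) ^ ?n)" "\<not> integrable ?\<sigma> f"
      using False borel_measurable_integrable by blast+
    then show ?thesis
      by (simp add: not_integrable_integral_eq)
  qed
qed

section \<open>Gauss curvature and dual points\<close>

lemma det_matrix_compose:
  fixes f g :: "real^'n::finite \<Rightarrow> real^'n"
  assumes "linear f" "linear g"
  shows "det (matrix (\<lambda>x. f (g x))) = det (matrix f) * det (matrix g)"
  using matrix_compose[OF assms(2,1)] by (simp add: o_def det_mul)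

lemma det_matrix_scaleR_linear:
  fixes f :: "real^'n::finite \<Rightarrow> real^'n"
  shows "det (matrix (\<lambda>x. c *\<^sub>R f x)) = c ^ CARD('n) * det (matrix f)"
proof -
  have "matrix (\<lambda>x. c *\<^sub>R f x) = (\<chi> i. c *s (matrix f $ i))"
    by (simp add: matrix_def vec_eq_iff)
  then show ?thesis
    using det_rows_mul[of "\<lambda>_. c" "\<lambda>i. matrix f $ i"] by (simp add: vec_lambda_eta)
qed

text \<open>A rotation \<open>R\<close> carries a coordinate axis to the direction of
  \<open>b\<close>. In the rotated frame the map changes only column \<open>k\<close> of the
  identity matrix, and Cramer's rule reads off the determinant.\<close>

lemma det_identity_plus_rank_one:
  fixes a b :: "real^'n::finite"
  shows "det (matrix (\<lambda>x. x + (x \<bullet> b) *\<^sub>R a)) = 1 + a \<bullet> b"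
proof (cases "b = 0")
  case True
  then show ?thesis by (simp add: matrix_id_mat_1[unfolded id_def])
next
  case False
  obtain k :: 'n where True by simp
  define e where "e = b /\<^sub>R norm b"
  have "norm e = 1" using False by (simp add: e_def)
  obtain R :: "real^'n \<Rightarrow> real^'n" where R: "orthogonal_transformation R" "R (axis k 1) = e"
    by (rule orthogonal_transformation_exists_1[OF norm_axis_1[of k] \<open>norm e = 1\<close>])
  then have linR: "linear R" by (simp add: orthogonal_transformation_linear)
  have "surj R" using R(1) by (rule orthogonal_transformation_surj)
  define c where "c = inv R (norm b *\<^sub>R a)"
  have c: "R c = norm b *\<^sub>R a" unfolding c_def by (rule surj_f_inv_f[OF \<open>surj R\<close>])
  have b: "b = norm b *\<^sub>R e" using False by (simp add: e_def)
  have dotR: "R x \<bullet> R y = x \<bullet> y" for x y using R(1) by (simp add: orthogonal_transformation_def)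
  define E where "E x = x + (x $ k) *\<^sub>R c" for x
  have linE: "linear E" unfolding E_def by (rule linearI) (auto simp: algebra_simps)
  have lin: "linear (\<lambda>x. x + (x \<bullet> b) *\<^sub>R a)"
    by (rule linearI) (auto simp: algebra_simps)
  have RE: "R x + (R x \<bullet> b) *\<^sub>R a = R (E x)" for x
  proof -
    have "R x \<bullet> b = norm b * (R x \<bullet> R (axis k 1))" by (subst b) (simp add: R(2))
    also have "\<dots> = norm b * (x $ k)" by (simp add: dotR inner_axis)
    finally show ?thesis
      by (simp add: E_def linear_add[OF linR] linear_cmul[OF linR] c)
  qed
  have "det (matrix (\<lambda>x. x + (x \<bullet> b) *\<^sub>R a)) * det (matrix R) = det (matrix R) * det (matrix E)"
    unfolding det_matrix_compose[OF lin linR, symmetric] det_matrix_compose[OF linR linE, symmetric] RE ..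
  moreover have "det (matrix R) \<noteq> 0"
    using det_nz_iff_inj[OF linR] orthogonal_transformation_inj[OF R(1)] by blast
  ultimately have "det (matrix (\<lambda>x. x + (x \<bullet> b) *\<^sub>R a)) = det (matrix E)" by simp
  also have "matrix E = (\<chi> i j. if j = k then (mat 1 *v (axis k 1 + c)) $ i else mat 1 $ i $ j)"
    unfolding matrix_vector_mul_lid by (auto simp: matrix_def E_def vec_eq_iff mat_def axis_def)
  also have "det \<dots> = (axis k 1 + c) $ k"
    by (subst cramer_lemma) simp
  also have "\<dots> = 1 + c \<bullet> axis k 1"
    by (simp add: inner_axis)
  also have "c \<bullet> axis k 1 = a \<bullet> b"
  proof -
    have "c \<bullet> axis k 1 = norm b *\<^sub>R a \<bullet> e" using dotR[of c "axis k 1"] by (simp only: c R(2))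
    also have "\<dots> = a \<bullet> (norm b *\<^sub>R e)" by simp
    finally show ?thesis by (simp only: b[symmetric])
  qed
  finally show ?thesis .
qed

text \<open>Bouligand's contingent cone.\<close>

definition tangent_dir :: "'a::real_normed_vector set \<Rightarrow> 'a \<Rightarrow> 'a \<Rightarrow> bool" where
  "tangent_dir S p w \<longleftrightarrow>
     (\<exists>x t. (\<forall>k::nat. x k \<in> S \<and> (0::real) < t k) \<and> t \<longlonglongrightarrow> 0 \<and> (\<lambda>k. (x k - p) /\<^sub>R t k) \<longlonglongrightarrow> w)"

text \<open>The secant quotients converge and hence are bounded, so an error that is small relative
  to norm (x k - p) stays small after division by \<open>t k\<close>.\<close>

lemma has_derivative_along_sequence:
  fixes f :: "'a::real_normed_vector \<Rightarrow> 'b::real_normed_vector"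
  assumes D: "(f has_derivative D) (at p within S)"
    and x: "\<And>k. x k \<in> S" and t: "\<And>k. 0 < t k" "t \<longlonglongrightarrow> 0"
    and w: "(\<lambda>k. (x k - p) /\<^sub>R t k) \<longlonglongrightarrow> w"
  shows "(\<lambda>k. (f (x k) - f p) /\<^sub>R t k) \<longlonglongrightarrow> D w"
proof -
  let ?q = "\<lambda>k. (x k - p) /\<^sub>R t k"
  have bl: "bounded_linear D" using D has_derivative_bounded_linear by blast
  obtain M where M: "0 < M" "\<And>k. norm (?q k) \<le> M"
    using BseqE[OF convergent_imp_Bseq[OF convergentI[OF w]]] by blast
  have "(\<lambda>k. t k *\<^sub>R ?q k) \<longlonglongrightarrow> 0 *\<^sub>R w" using t(2) w by (rule tendsto_scaleR)
  moreover have "t k \<noteq> 0" for k using t(1)[of k] by simp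
  ultimately have xp: "(\<lambda>k. x k - p) \<longlonglongrightarrow> 0" by simp
  have "(\<lambda>k. (f (x k) - f p) /\<^sub>R t k - D (?q k)) \<longlonglongrightarrow> 0"
  proof (rule LIMSEQ_I)
    fix e :: real assume "0 < e"
    \<comment> \<open>\<open>M\<close> bounds the secant quotients, so this relative error
      contributes at most e / 2 after division by \<open>t k\<close>.\<close>
    then have "0 < e / (2 * M)" using M by simp
    then obtain d where d: "0 < d"
      "\<And>y. y \<in> S \<Longrightarrow> norm (y - p) < d \<Longrightarrow> norm (f y - f p - D (y - p)) \<le> e / (2 * M) * norm (y - p)"
      using D unfolding has_derivative_within_alt by blast
    obtain N where N: "\<And>k. k \<ge> N \<Longrightarrow> norm (x k - p) < d"
      using LIMSEQ_D[OF xp \<open>0 < d\<close>] by auto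
    have "norm ((f (x k) - f p) /\<^sub>R t k - D (?q k) - 0) < e" if "k \<ge> N" for k
    proof -
      have "(f (x k) - f p) /\<^sub>R t k - D (?q k) = (f (x k) - f p - D (x k - p)) /\<^sub>R t k"
        unfolding linear_cmul[OF bounded_linear.linear[OF bl]] by (simp add: scaleR_diff_right)
      then have "norm ((f (x k) - f p) /\<^sub>R t k - D (?q k)) = norm ((f (x k) - f p - D (x k - p)) /\<^sub>R t k)"
        by (simp only:)
      also have "\<dots> = norm (f (x k) - f p - D (x k - p)) / t k"
        using t(1)[of k] by (simp add: divide_inverse mult.commute)
      also have "\<dots> \<le> e / (2 * M) * norm (x k - p) / t k"
        using t(1)[of k] by (intro divide_right_mono[OF d(2)[OF x N[OF that]]]) simp
      also have "\<dots> = e / (2 * M) * (norm (x k - p) / t k)"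
        by (rule times_divide_eq_right[symmetric])
      also have "norm (x k - p) / t k = norm (?q k)"
        using t(1)[of k] by (simp add: divide_inverse mult.commute)
      also have "e / (2 * M) * norm (?q k) \<le> e / (2 * M) * M"
        using M \<open>0 < e\<close> by (intro mult_left_mono) auto
      also have "\<dots> < e" using M \<open>0 < e\<close> by simp
      finally show ?thesis by simp
    qed
    then show "\<exists>N. \<forall>k\<ge>N. norm ((f (x k) - f p) /\<^sub>R t k - D (?q k) - 0) < e" by blast
  qed
  from tendsto_add[OF this bounded_linear.tendsto[OF bl w]] show ?thesis by simp
qed

text \<open>Takes the place of uniqueness of the derivative, which fails within a hypersurface in
  transversal directions.\<close>

lemma has_derivative_within_unique_tangent:
  assumes "(f has_derivative D) (at p within S)" "(f has_derivative D') (at p within S)"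
    and "tangent_dir S p w"
  shows "D w = D' w"
proof -
  obtain x and t :: "nat \<Rightarrow> real" where xt: "\<And>k. x k \<in> S" "\<And>k. 0 < t k" "t \<longlonglongrightarrow> 0"
      "(\<lambda>k. (x k - p) /\<^sub>R t k) \<longlonglongrightarrow> w"
    using assms(3) unfolding tangent_dir_def by blast
  show ?thesis
    using has_derivative_along_sequence[OF assms(1) xt] has_derivative_along_sequence[OF assms(2) xt]
    by (rule LIMSEQ_unique)
qed

section \<open>Dual points, unit normals and Gauss curvature\<close>

lemma has_derivative_normalize:
  fixes y :: "'a::real_inner"
  assumes "y \<noteq> 0"
  defines "u \<equiv> y /\<^sub>R norm y"
  shows "((\<lambda>x. x /\<^sub>R norm x) has_derivative (\<lambda>v. (v - (v \<bullet> u) *\<^sub>R u) /\<^sub>R norm y)) (at y)"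
proof -
  have "norm y \<noteq> 0" using assms(1) by simp
  note has_derivative_scaleR[OF Deriv.has_derivative_inverse[OF this has_derivative_norm[OF assms(1)]]
      has_derivative_ident]
  then show ?thesis
    by (rule has_derivative_eq_rhs)
      (simp add: fun_eq_iff u_def sgn_div_norm algebra_simps divide_inverse)
qed

text \<open>A boundary point of the polar body: the hyperplane where the inner product with it is 1
  supports \<open>K\<close> at \<open>p\<close>. Normalising by this inner product instead of the
  length is what makes the notion compatible with linear maps, which do not preserve
  lengths.\<close>

definition dual_point :: "'a::real_inner set \<Rightarrow> 'a \<Rightarrow> 'a" where
  "dual_point K p = (THE y. p \<bullet> y = 1 \<and> (\<forall>x\<in>K. x \<bullet> y \<le> 1))"

text \<open>The last clause says that the contingent cone of the boundary contains the whole
  supporting hyperplane direction; it is what pins down derivatives within the boundary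
  there.\<close>

definition regular_body :: "(real^'n::finite) set \<Rightarrow> bool" where
  "regular_body K \<longleftrightarrow> convex K \<and> compact K \<and> 0 \<in> interior K \<and>
     (\<forall>p\<in>frontier K. (\<exists>!y. p \<bullet> y = 1 \<and> (\<forall>x\<in>K. x \<bullet> y \<le> 1)) \<and>
        (\<exists>L. (dual_point K has_derivative L) (at p within frontier K)) \<and>
        (\<forall>w. w \<bullet> dual_point K p = 0 \<longrightarrow> tangent_dir (frontier K) p w))"

lemma supporting_pos:
  fixes u :: "'a::real_inner"
  assumes "0 \<in> interior K" "u \<noteq> 0" "\<And>y. y \<in> K \<Longrightarrow> y \<bullet> u \<le> c"
  shows "0 < c"
proof -
  obtain e where e: "0 < e" "ball 0 e \<subseteq> K" using assms(1) mem_interior by blast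
  let ?y = "(e / 2 / norm u) *\<^sub>R u"
  have "norm ?y < e" using e assms(2) by simp
  then have "?y \<in> K" using e(2) by auto
  then have "?y \<bullet> u \<le> c" using assms(3) by blast
  moreover have "0 < ?y \<bullet> u" using e assms(2) by simp
  ultimately show ?thesis by linarith
qed

context
  fixes K :: "(real^'n::finite) set"
  assumes K: "regular_body K"
begin

lemma dual_point:
  assumes "p \<in> frontier K"
  shows "p \<bullet> dual_point K p = 1" "x \<in> K \<Longrightarrow> x \<bullet> dual_point K p \<le> 1" "dual_point K p \<noteq> 0"
proof -
  have "\<exists>!y. p \<bullet> y = 1 \<and> (\<forall>x\<in>K. x \<bullet> y \<le> 1)" using K assms by (simp add: regular_body_def)
  from theI'[OF this] show "p \<bullet> dual_point K p = 1" "x \<in> K \<Longrightarrow> x \<bullet> dual_point K p \<le> 1"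
    by (auto simp: dual_point_def)
  then show "dual_point K p \<noteq> 0" by auto
qed

lemma dual_point_unique:
  assumes "p \<in> frontier K" "p \<bullet> y = 1" "\<And>x. x \<in> K \<Longrightarrow> x \<bullet> y \<le> 1"
  shows "y = dual_point K p"
  using K assms dual_point[OF assms(1)] unfolding regular_body_def by blast

text \<open>Since 0 is interior, \<open>p \<bullet> u\<close> is positive for an outer normal
  \<open>u\<close>, so unit normals and dual points are positive multiples of each other. Uniqueness
  of the dual point thus makes the \<open>THE\<close> in \<open>outer_normal\<close> well
  defined.\<close>

lemma outer_normal_iff:
  assumes "p \<in> frontier K"
  shows "norm u = 1 \<and> (\<forall>y\<in>K. y \<bullet> u \<le> p \<bullet> u) \<longleftrightarrow> u = dual_point K p /\<^sub>R norm (dual_point K p)"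
proof
  assume u: "norm u = 1 \<and> (\<forall>y\<in>K. y \<bullet> u \<le> p \<bullet> u)"
  then have pos: "0 < p \<bullet> u" using supporting_pos[of K u "p \<bullet> u"] K by (force simp: regular_body_def)
  then have "u /\<^sub>R (p \<bullet> u) = dual_point K p"
    using u by (intro dual_point_unique assms) (auto simp: field_simps)
  then have "(p \<bullet> u) *\<^sub>R (u /\<^sub>R (p \<bullet> u)) = (p \<bullet> u) *\<^sub>R dual_point K p" by (simp only:)
  then have "u = (p \<bullet> u) *\<^sub>R dual_point K p" using pos by simp
  moreover from this have "(p \<bullet> u) * norm (dual_point K p) = 1"
    using u pos by (metis abs_of_pos norm_scaleR)
  ultimately show "u = dual_point K p /\<^sub>R norm (dual_point K p)"
    by (metis inverse_unique mult.commute)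
next
  assume "u = dual_point K p /\<^sub>R norm (dual_point K p)"
  then show "norm u = 1 \<and> (\<forall>y\<in>K. y \<bullet> u \<le> p \<bullet> u)"
    using dual_point[OF assms] by (simp add: mult_left_le)
qed

lemma outer_normal_eq:
  assumes "p \<in> frontier K"
  shows "outer_normal K p = dual_point K p /\<^sub>R norm (dual_point K p)"
  unfolding outer_normal_def outer_normal_iff[OF assms] by simp

lemma outer_normal_has_derivative:
  assumes p: "p \<in> frontier K" and L: "(dual_point K has_derivative L) (at p within frontier K)"
  shows "(outer_normal K has_derivative
      (\<lambda>v. (L v - (L v \<bullet> outer_normal K p) *\<^sub>R outer_normal K p) /\<^sub>R norm (dual_point K p)))
    (at p within frontier K)"
proof -
  have "((\<lambda>x. dual_point K x /\<^sub>R norm (dual_point K x)) has_derivative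
      (\<lambda>v. (L v - (L v \<bullet> outer_normal K p) *\<^sub>R outer_normal K p) /\<^sub>R norm (dual_point K p)))
    (at p within frontier K)"
    using has_derivative_compose[OF L has_derivative_normalize[OF dual_point(3)[OF p]]]
    by (simp add: outer_normal_eq[OF p])
  then show ?thesis
    by (rule has_derivative_transform[rotated 2]) (use p outer_normal_eq in auto)
qed

text \<open>The determinant below is that of the differential of the dual point map, as a map from
  \<open>u\<^sup>\<bottom>\<close> to \<open>p\<^sup>\<bottom>\<close>, extended by sending \<open>p\<close> to its dual point.
  In contrast to the Weingarten map it transforms linearly with \<open>K\<close>.\<close>

lemma gauss_curvature_eq:
  assumes p: "p \<in> frontier K" and L: "(dual_point K has_derivative L) (at p within frontier K)"
  shows "gauss_curvature K p
    = det (matrix (\<lambda>x. L (x - (x \<bullet> dual_point K p) *\<^sub>R p) + (x \<bullet> dual_point K p) *\<^sub>R dual_point K p))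
      / norm (dual_point K p) ^ (CARD('n) + 1)"
proof -
  let ?n = "CARD('n)"
  define \<nu> where "\<nu> = dual_point K p"
  define u where "u = outer_normal K p"
  define D where "D = (SOME D. (outer_normal K has_derivative D) (at p within frontier K))"
  define \<Lambda> where "\<Lambda> x = L (x - (x \<bullet> \<nu>) *\<^sub>R p) + (x \<bullet> \<nu>) *\<^sub>R \<nu>" for x
  have L': "(dual_point K has_derivative L) (at p within frontier K)" using L .
  have linL: "linear L" using L has_derivative_linear by blast
  have \<nu>: "\<nu> \<noteq> 0" "p \<bullet> \<nu> = 1" using dual_point[OF p] by (auto simp: \<nu>_def)
  have u: "u = \<nu> /\<^sub>R norm \<nu>" "norm u = 1" "u \<bullet> u = 1"
    using \<nu> by (auto simp: u_def \<nu>_def outer_normal_eq[OF p] dot_square_norm)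
  have pu: "p \<bullet> u = 1 / norm \<nu>" using \<nu> u by (simp add: divide_inverse)
  note N = outer_normal_has_derivative[OF p L, folded \<nu>_def u_def]
  then have D: "(outer_normal K has_derivative D) (at p within frontier K)"
    unfolding D_def by (rule someI[where P = "\<lambda>D. (outer_normal K has_derivative D) (at p within frontier K)"])
  then have linD: "linear D" using has_derivative_linear by blast
  have tan: "tangent_dir (frontier K) p w" if "w \<bullet> u = 0" for w
    using K p that \<nu> by (simp add: regular_body_def u flip: \<nu>_def)
  \<comment> \<open>The chosen \<open>D\<close> and the explicit derivative may differ off the
    tangent hyperplane; tangent directions force agreement on it.\<close>
  have D_tan: "D w = (L w - (L w \<bullet> u) *\<^sub>R u) /\<^sub>R norm \<nu>" if "w \<bullet> u = 0" for w
    using has_derivative_within_unique_tangent[OF D N tan[OF that]] .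
  \<comment> \<open>Differentiating the constant \<open>x \<bullet> dual_point K x\<close> along the
    boundary shows that \<open>L\<close> maps the tangent hyperplane into the orthogonal complement
    of \<open>p\<close>.\<close>
  have Lp: "L w \<bullet> p = 0" if "w \<bullet> u = 0" for w
  proof -
    have "((\<lambda>x. x \<bullet> dual_point K x) has_derivative (\<lambda>v. p \<bullet> L v + v \<bullet> \<nu>)) (at p within frontier K)"
      unfolding \<nu>_def by (rule derivative_eq_intros L' refl)+
    moreover have "((\<lambda>x. x \<bullet> dual_point K x) has_derivative (\<lambda>v. 0)) (at p within frontier K)"
      by (rule has_derivative_transform[where f = "\<lambda>x. 1"]) (use p dual_point(1) in auto)
    ultimately have "p \<bullet> L w + w \<bullet> \<nu> = 0"
      using has_derivative_within_unique_tangent tan[OF that] by blast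
    moreover have "w \<bullet> \<nu> = 0" using that u \<nu> by simp
    ultimately show ?thesis by (simp add: inner_commute)
  qed
  \<comment> \<open>\<open>?B\<close> fixes the complement of \<open>u\<close> and sends
    \<open>u\<close> to \<open>p\<close>, entering the domain where \<Lambda> is split into
    \<open>L\<close> and the normal part. \<open>?C\<close> projects the complement of
    \<open>p\<close> along \<open>u\<close> onto that of \<open>u\<close> and sends \<open>u\<close>
    to \<open>(p \<bullet> u) *\<^sub>R u\<close>. \<open>?S\<close> stretches \<open>u\<close> by
    norm \<nu>, so that the overall factor 1 / norm \<nu>, which normalisation puts on the tangent
    part, leaves \<open>u\<close> fixed.\<close>
  let ?B = "\<lambda>x. x + (x \<bullet> u) *\<^sub>R (p - u)" and ?C = "\<lambda>x. x + (x \<bullet> (p - u)) *\<^sub>R u"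
    and ?S = "\<lambda>x. x + (x \<bullet> u) *\<^sub>R ((norm \<nu> - 1) *\<^sub>R u)"
  have lin: "linear ?B" "linear ?C" "linear ?S" "linear \<Lambda>"
    by (auto intro!: linearI simp: algebra_simps \<Lambda>_def linear_add[OF linL] linear_diff[OF linL] linear_cmul[OF linL])
  have "D (x - (x \<bullet> u) *\<^sub>R u) + (x \<bullet> u) *\<^sub>R u = (1 / norm \<nu>) *\<^sub>R ?S (?C (\<Lambda> (?B x)))" for x
  proof -
    define w where "w = x - (x \<bullet> u) *\<^sub>R u"
    have w: "w \<bullet> u = 0" by (simp add: w_def inner_diff_left u(3))
    then have w': "w \<bullet> \<nu> = 0" using u \<nu> by simp
    have "?B x = w + (x \<bullet> u) *\<^sub>R p" by (simp add: w_def algebra_simps)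
    then have "?B x \<bullet> \<nu> = x \<bullet> u" using w' \<nu> by (simp add: inner_add_left)
    then have "\<Lambda> (?B x) = L w + (x \<bullet> u) *\<^sub>R \<nu>"
      by (simp add: \<Lambda>_def w_def algebra_simps)
    moreover have "\<nu> = norm \<nu> *\<^sub>R u" using u \<nu> by simp
    ultimately have \<Lambda>B: "\<Lambda> (?B x) = L w + (x \<bullet> u * norm \<nu>) *\<^sub>R u" by (metis scaleR_scaleR)
    have "norm \<nu> \<noteq> 0" using \<nu> by simp
    then have "?C (\<Lambda> (?B x)) = L w - (L w \<bullet> u) *\<^sub>R u + (x \<bullet> u) *\<^sub>R u"
      unfolding \<Lambda>B using Lp[OF w] pu u(3)
      by (simp add: inner_add_left inner_diff_right inner_commute[of u p] algebra_simps)
    moreover have "?S (y + c *\<^sub>R u) = y + (norm \<nu> * c) *\<^sub>R u" if "y \<bullet> u = 0" for y c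
      using u(3) that by (simp add: inner_add_left algebra_simps)
    moreover have "(L w - (L w \<bullet> u) *\<^sub>R u) \<bullet> u = 0"
      using u(3) by (simp add: inner_diff_left)
    ultimately have "?S (?C (\<Lambda> (?B x))) = L w - (L w \<bullet> u) *\<^sub>R u + (norm \<nu> * (x \<bullet> u)) *\<^sub>R u"
      by presburger
    then show ?thesis
      using \<open>norm \<nu> \<noteq> 0\<close> D_tan[OF w] by (simp add: w_def[symmetric] scaleR_add_right divide_inverse)
  qed
  then have "gauss_curvature K p = det (matrix (\<lambda>x. (1 / norm \<nu>) *\<^sub>R ?S (?C (\<Lambda> (?B x)))))"
    by (simp add: gauss_curvature_def Let_def D_def[symmetric] u_def[symmetric])
  also have "\<dots> = (1 / norm \<nu>) ^ ?n * (det (matrix ?S) * (det (matrix ?C) * (det (matrix \<Lambda>) * det (matrix ?B))))"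
  proof -
    have l: "linear (\<lambda>x. \<Lambda> (?B x))" "linear (\<lambda>x. ?C (\<Lambda> (?B x)))"
      using linear_compose[OF lin(1) lin(4)] linear_compose[OF linear_compose[OF lin(1) lin(4)] lin(2)]
      by (simp_all add: o_def)
    show ?thesis
      unfolding det_matrix_scaleR_linear[of "1 / norm \<nu>" "\<lambda>x. ?S (?C (\<Lambda> (?B x)))"]
        det_matrix_compose[OF lin(3) l(2)] det_matrix_compose[OF lin(2) l(1)]
        det_matrix_compose[OF lin(4) lin(1)] ..
  qed
  also have "\<dots> = det (matrix \<Lambda>) / norm \<nu> ^ (?n + 1)"
  proof -
    \<comment> \<open>Each map is a rank one perturbation of the identity. The powers of norm \<nu>
      are -n from the scalar, +1 from \<open>?S\<close> and -1 each from \<open>?B\<close> and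
      \<open>?C\<close>, in total -(n+1).\<close>
    have d: "det (matrix ?S) = norm \<nu>" "det (matrix ?C) = 1 / norm \<nu>" "det (matrix ?B) = 1 / norm \<nu>"
      unfolding det_identity_plus_rank_one
      using u(3) pu by (simp_all add: inner_diff_left inner_diff_right inner_commute[of u p])
    show ?thesis
      unfolding d using \<nu>(1) by (simp add: power_one_over field_simps)
  qed
  finally show ?thesis
    by (simp add: \<Lambda>_def[abs_def] \<nu>_def)
qed

end

section \<open>Bodies of class \<open>C\<^sup>2\<^sub>+\<close>\<close>

text \<open>A zero of \<open>\<rho>\<close> near \<open>p + t w\<close> is found by the intermediate value theorem on the segment from
  \<open>p + t (w - \<epsilon> a)\<close> to \<open>p + t (w + \<epsilon> a)\<close>.\<close>

lemma level_set_tangent_aux: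
  fixes \<rho> :: "'a::real_inner \<Rightarrow> real"
  assumes U: "open U" "p \<in> U" "continuous_on U \<rho>" "\<rho> p = 0"
    and D: "(\<rho> has_derivative (\<lambda>v. a \<bullet> v)) (at p)" and a: "a \<noteq> 0" and w: "w \<bullet> a = 0" and "0 < \<epsilon>"
  shows "\<exists>t s. 0 < t \<and> t < \<epsilon> \<and> \<bar>s\<bar> \<le> \<epsilon> * t \<and> p + t *\<^sub>R w + s *\<^sub>R a \<in> U \<and> \<rho> (p + t *\<^sub>R w + s *\<^sub>R a) = 0"
proof -
  obtain r where r: "0 < r" "ball p r \<subseteq> U" using U(1,2) openE by blast
  have dir: "((\<lambda>t. \<rho> (p + t *\<^sub>R v)) has_real_derivative a \<bullet> v) (at 0)" for v
  proof -
    have "((\<lambda>t. p + t *\<^sub>R v) has_derivative (\<lambda>t. t *\<^sub>R v)) (at 0)"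
      by (auto intro!: derivative_eq_intros)
    then have "((\<lambda>t. \<rho> (p + t *\<^sub>R v)) has_derivative (\<lambda>t. a \<bullet> (t *\<^sub>R v))) (at 0)"
      using has_derivative_compose[of "\<lambda>t. p + t *\<^sub>R v" "\<lambda>t. t *\<^sub>R v" 0 UNIV \<rho> "\<lambda>v. a \<bullet> v"] D by simp
    then show ?thesis
      by (simp add: has_field_derivative_def mult_commute_abs)
  qed
  have "a \<bullet> (w + \<epsilon> *\<^sub>R a) > 0" "a \<bullet> (w - \<epsilon> *\<^sub>R a) < 0"
    using w a \<open>0 < \<epsilon>\<close> by (simp_all add: inner_add_right inner_diff_right inner_commute)
  from DERIV_pos_inc_right[OF dir this(1)] DERIV_neg_dec_right[OF dir this(2)]
  obtain d1 d2 where d: "0 < d1" "0 < d2"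
    "\<And>h. 0 < h \<Longrightarrow> h < d1 \<Longrightarrow> 0 < \<rho> (p + h *\<^sub>R (w + \<epsilon> *\<^sub>R a))"
    "\<And>h. 0 < h \<Longrightarrow> h < d2 \<Longrightarrow> \<rho> (p + h *\<^sub>R (w - \<epsilon> *\<^sub>R a)) < 0"
    using U(4) by auto
  \<comment> \<open>For \<open>\<bar>s\<bar> \<le> \<epsilon> * t\<close> the displacement has norm
    less than t * M, so t < r / M keeps the whole segment inside the ball in
    \<open>U\<close>.\<close>
  define M where "M = norm w + \<epsilon> * norm a + 1"
  have M: "0 < M" using \<open>0 < \<epsilon>\<close> by (simp add: M_def add_nonneg_pos)
  have "0 < min (min d1 d2) (min \<epsilon> (r / M))" using d(1,2) r(1) M \<open>0 < \<epsilon>\<close> by simp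
  from dense[OF this] obtain t where t: "0 < t" "t < d1" "t < d2" "t < \<epsilon>" "t < r / M"
    by auto
  have in_ball: "p + t *\<^sub>R w + s *\<^sub>R a \<in> U" if "\<bar>s\<bar> \<le> \<epsilon> * t" for s
  proof -
    have "norm (t *\<^sub>R w + s *\<^sub>R a) \<le> t * norm w + \<bar>s\<bar> * norm a"
      using norm_triangle_ineq[of "t *\<^sub>R w" "s *\<^sub>R a"] t(1) by simp
    also have "\<dots> \<le> t * norm w + (\<epsilon> * t) * norm a"
      using that by (intro add_left_mono mult_right_mono) auto
    also have "\<dots> < t * M" using t(1) by (simp add: M_def algebra_simps)
    also have "\<dots> < r" using t(5) M by (simp add: field_simps)
    also have "norm (t *\<^sub>R w + s *\<^sub>R a) = dist p (p + (t *\<^sub>R w + s *\<^sub>R a))"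
      by (metis add_diff_cancel_left' dist_commute dist_norm)
    finally have "p + (t *\<^sub>R w + s *\<^sub>R a) \<in> ball p r" by simp
    then show ?thesis using r(2) by (auto simp: add.assoc)
  qed
  have "continuous_on {- (\<epsilon> * t)..\<epsilon> * t} (\<lambda>s. \<rho> (p + t *\<^sub>R w + s *\<^sub>R a))"
    by (rule continuous_on_compose2[OF U(3)]) (auto intro!: continuous_intros in_ball)
  moreover have "\<rho> (p + t *\<^sub>R w + (- (\<epsilon> * t)) *\<^sub>R a) \<le> 0" "0 \<le> \<rho> (p + t *\<^sub>R w + (\<epsilon> * t) *\<^sub>R a)"
    using d(3)[OF t(1,2)] d(4)[OF t(1,3)] by (simp_all add: algebra_simps)
  moreover have "- (\<epsilon> * t) \<le> \<epsilon> * t" using t(1) \<open>0 < \<epsilon>\<close> by simp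
  ultimately obtain s where s: "- (\<epsilon> * t) \<le> s" "s \<le> \<epsilon> * t" "\<rho> (p + t *\<^sub>R w + s *\<^sub>R a) = 0"
    using IVT'[of "\<lambda>s. \<rho> (p + t *\<^sub>R w + s *\<^sub>R a)" "- (\<epsilon> * t)" 0 "\<epsilon> * t"] by blast
  then have "\<bar>s\<bar> \<le> \<epsilon> * t" by simp
  then show ?thesis using t s(3) in_ball by blast
qed

text \<open>Taking \<open>\<epsilon>\<close> = 1 / (k + 1) in the preceding lemma gives points p + t
  w + s a of the level set with t and s / t tending to 0, so the secant quotients w + (s / t) a tend
  to w.\<close>

lemma level_set_tangent:
  fixes \<rho> :: "'a::real_inner \<Rightarrow> real"
  assumes S: "S \<inter> U = {x \<in> U. \<rho> x = 0}" "p \<in> S" and U: "open U" "p \<in> U" "continuous_on U \<rho>"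
    and D: "(\<rho> has_derivative (\<lambda>v. a \<bullet> v)) (at p)" and a: "a \<noteq> 0" and w: "w \<bullet> a = 0"
  shows "tangent_dir S p w"
proof -
  have \<rho>p: "\<rho> p = 0" using S U(2) by blast
  have "\<forall>k. \<exists>t s. 0 < t \<and> t < inverse (real (Suc k)) \<and> \<bar>s\<bar> \<le> inverse (real (Suc k)) * t
      \<and> p + t *\<^sub>R w + s *\<^sub>R a \<in> U \<and> \<rho> (p + t *\<^sub>R w + s *\<^sub>R a) = 0"
    using level_set_tangent_aux[OF U \<rho>p D a w] by simp
  then obtain t s where ts: "\<And>k. 0 < t k" "\<And>k. t k < inverse (real (Suc k))"
      "\<And>k. \<bar>s k\<bar> \<le> inverse (real (Suc k)) * t k"
      "\<And>k. p + t k *\<^sub>R w + s k *\<^sub>R a \<in> U \<and> \<rho> (p + t k *\<^sub>R w + s k *\<^sub>R a) = 0"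
    by metis
  have "t \<longlonglongrightarrow> 0"
  proof (rule Lim_null_comparison[OF _ LIMSEQ_inverse_real_of_nat])
    show "\<forall>\<^sub>F k in sequentially. norm (t k) \<le> inverse (real (Suc k))"
      using ts(1,2) by (intro always_eventually allI) (simp add: less_imp_le abs_of_pos)
  qed
  moreover have "(\<lambda>k. ((p + t k *\<^sub>R w + s k *\<^sub>R a) - p) /\<^sub>R t k) \<longlonglongrightarrow> w"
  proof -
    have "\<bar>s k / t k\<bar> \<le> inverse (real (Suc k))" for k
      using ts(1)[of k] ts(3)[of k] by (simp add: abs_divide pos_divide_le_eq)
    then have "(\<lambda>k. s k / t k) \<longlonglongrightarrow> 0"
      by (intro Lim_null_comparison[OF _ LIMSEQ_inverse_real_of_nat] always_eventually) simp
    then have "(\<lambda>k. w + (s k / t k) *\<^sub>R a) \<longlonglongrightarrow> w + 0 *\<^sub>R a"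
      by (intro tendsto_intros)
    moreover have "((p + t k *\<^sub>R w + s k *\<^sub>R a) - p) /\<^sub>R t k = w + (s k / t k) *\<^sub>R a" for k
      using ts(1)[of k] by (simp add: scaleR_add_right divide_inverse mult.commute)
    ultimately show ?thesis by simp
  qed
  moreover have "p + t k *\<^sub>R w + s k *\<^sub>R a \<in> S" for k using ts(4)[of k] S(1) by blast
  ultimately show ?thesis
    unfolding tangent_dir_def using ts(1)
    by (intro exI[of _ "\<lambda>k. p + t k *\<^sub>R w + s k *\<^sub>R a"] exI[of _ t]) simp
qed

lemma tangent_dir_supporting:
  assumes "tangent_dir S p w" "\<And>x. x \<in> S \<Longrightarrow> x \<bullet> y \<le> p \<bullet> y"
  shows "w \<bullet> y \<le> 0"
proof -
  obtain x and t :: "nat \<Rightarrow> real" where xt: "\<And>k. x k \<in> S" "\<And>k. 0 < t k"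
      "(\<lambda>k. (x k - p) /\<^sub>R t k) \<longlonglongrightarrow> w"
    using assms(1) unfolding tangent_dir_def by blast
  have "(\<lambda>k. ((x k - p) /\<^sub>R t k) \<bullet> y) \<longlonglongrightarrow> w \<bullet> y"
    using xt(3) by (intro tendsto_inner tendsto_const)
  moreover have "((x k - p) /\<^sub>R t k) \<bullet> y \<le> 0" for k
    using assms(2)[OF xt(1)[of k]] xt(2)[of k]
    by (simp add: inner_diff_left mult_nonneg_nonpos)
  ultimately show ?thesis
    by (intro tendsto_upperbound[where F = sequentially]) (auto intro!: always_eventually)
qed

text \<open>A supporting hyperplane at \<open>p\<close> misses the interior point 0, so its equation
  can be normalised to have right-hand side 1.\<close>

lemma exists_supporting_dual:
  fixes K :: "'a::euclidean_space set"
  assumes "convex K" "compact K" "0 \<in> interior K" "p \<in> frontier K"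
  shows "\<exists>y. p \<bullet> y = 1 \<and> (\<forall>x\<in>K. x \<bullet> y \<le> 1)"
proof -
  have "closed K" using assms(2) by (rule compact_imp_closed)
  then have p: "p \<in> K" "p \<notin> interior K"
    using assms(4) frontier_subset_closed by (auto simp: frontier_def)
  have "rel_interior K = interior K" using assms(3) rel_interior_nonempty_interior by blast
  then obtain a where a: "a \<noteq> 0" "\<And>y. y \<in> K \<Longrightarrow> a \<bullet> p \<le> a \<bullet> y"
    using supporting_hyperplane_rel_boundary[OF assms(1) p(1)] p(2) by metis
  define u where "u = - a"
  have u: "u \<noteq> 0" "\<And>y. y \<in> K \<Longrightarrow> y \<bullet> u \<le> p \<bullet> u"
    using a by (simp_all add: u_def inner_commute[of _ a])
  have "0 < p \<bullet> u" by (rule supporting_pos[OF assms(3) u])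
  then show ?thesis
    using u(2) by (intro exI[of _ "u /\<^sub>R (p \<bullet> u)"]) (simp add: divide_inverse[symmetric] mult.commute[of "inverse _"])
qed

text \<open>Near \<open>p\<close> the boundary is a level set with gradient \<open>g\<close>. Every
  supporting functional at a boundary point there is parallel to \<open>g\<close>, so the dual point
  is \<open>g x\<close> divided by \<open>x \<bullet> g x\<close>, and it inherits differentiability
  from \<open>g\<close>.\<close>

lemma C2_plus_regular_body:
  assumes "K \<in> C2_plus"
  shows "regular_body K"
proof -
  have K: "convex K" "compact K" "0 \<in> interior K" and C2: "C2_hypersurface (frontier K)"
    using assms by (auto simp: C2_plus_def convex_body_def)
  have FK: "frontier K \<subseteq> K" using K(2) by (simp add: compact_imp_closed frontier_subset_closed)
  show ?thesis
    unfolding regular_body_def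
  proof (intro conjI ballI K)
    fix p assume p: "p \<in> frontier K"
    from bspec[OF C2[unfolded C2_hypersurface_def] p]
    obtain U \<rho> g H where "open U \<and> p \<in> U \<and> frontier K \<inter> U = {x \<in> U. \<rho> x = 0} \<and>
        (\<forall>x\<in>U. (\<rho> has_derivative (\<lambda>v. g x \<bullet> v)) (at x) \<and>
               (g has_derivative (\<lambda>v. H x *v v)) (at x) \<and> g x \<noteq> 0) \<and> continuous_on U H"
      by (elim exE)
    then have U: "open U" "p \<in> U" "frontier K \<inter> U = {x \<in> U. \<rho> x = 0}"
      and \<rho>: "\<And>x. x \<in> U \<Longrightarrow> (\<rho> has_derivative (\<lambda>v. g x \<bullet> v)) (at x)"
      and g: "\<And>x. x \<in> U \<Longrightarrow> (g has_derivative (\<lambda>v. H x *v v)) (at x)" "\<And>x. x \<in> U \<Longrightarrow> g x \<noteq> 0"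
      by simp_all
    have cont: "continuous_on U \<rho>"
      using \<rho> by (intro continuous_at_imp_continuous_on ballI has_derivative_continuous)
    have tan: "tangent_dir (frontier K) x w" if "x \<in> frontier K \<inter> U" "w \<bullet> g x = 0" for x w
      using that by (intro level_set_tangent[OF U(3) _ U(1) _ cont \<rho> g(2)]) auto
    have unique: "y = g x /\<^sub>R (x \<bullet> g x) \<and> x \<bullet> g x \<noteq> 0"
      if x: "x \<in> frontier K \<inter> U" and y: "x \<bullet> y = 1" "\<And>z. z \<in> K \<Longrightarrow> z \<bullet> y \<le> 1" for x y
    proof -
      \<comment> \<open>Both w and -w are tangent, and a supporting functional is nonpositive on
        tangent directions.\<close>
      have perp: "w \<bullet> y = 0" if "w \<bullet> g x = 0" for w
      proof -
        have "z \<bullet> y \<le> x \<bullet> y" if "z \<in> frontier K" for z using y that FK by auto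
        then have "w' \<bullet> y \<le> 0" if "w' \<bullet> g x = 0" for w'
          using tangent_dir_supporting[OF tan[OF x that]] by blast
        from this[of w] this[of "- w"] show ?thesis using that by simp
      qed
      have gx: "g x \<bullet> g x \<noteq> 0" using g(2) x by simp
      \<comment> \<open>The projection coefficient of y onto \<open>g x\<close>. The remainder is
        orthogonal to \<open>g x\<close>, hence by \<open>perp\<close> to y, hence to
        itself.\<close>
      define c where "c = (y \<bullet> g x) / (g x \<bullet> g x)"
      have 0: "(y - c *\<^sub>R g x) \<bullet> g x = 0" using gx by (simp add: c_def inner_diff_left)
      from perp[OF this] have "(y - c *\<^sub>R g x) \<bullet> (y - c *\<^sub>R g x) = 0"
        using 0 by (simp add: inner_diff_right)
      then have yc: "y = c *\<^sub>R g x" by simp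
      then have "c * (x \<bullet> g x) = 1" using y(1) by simp
      then have "x \<bullet> g x \<noteq> 0" "c = inverse (x \<bullet> g x)"
        by (auto simp: inverse_unique[symmetric] mult.commute)
      then show ?thesis using yc by simp
    qed
    show "\<exists>!y. p \<bullet> y = 1 \<and> (\<forall>x\<in>K. x \<bullet> y \<le> 1)"
    proof -
      obtain y where y: "p \<bullet> y = 1 \<and> (\<forall>x\<in>K. x \<bullet> y \<le> 1)"
        using exists_supporting_dual[OF K p] by blast
      have "z = g p /\<^sub>R (p \<bullet> g p)" if "p \<bullet> z = 1 \<and> (\<forall>x\<in>K. x \<bullet> z \<le> 1)" for z
        using unique[OF IntI[OF p U(2)], of z] that by blast
      then show ?thesis using y by (intro ex1I[of _ y]) auto
    qed
    have dual: "dual_point K x = g x /\<^sub>R (x \<bullet> g x) \<and> x \<bullet> g x \<noteq> 0" if x: "x \<in> frontier K \<inter> U" for x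
    proof -
      obtain y where y: "x \<bullet> y = 1 \<and> (\<forall>z\<in>K. z \<bullet> y \<le> 1)"
        using exists_supporting_dual[OF K] x by blast
      have G: "z = g x /\<^sub>R (x \<bullet> g x)" "x \<bullet> g x \<noteq> 0" if "x \<bullet> z = 1 \<and> (\<forall>z'\<in>K. z' \<bullet> z \<le> 1)" for z
        using unique[OF x, of z] that by blast+
      have "dual_point K x = g x /\<^sub>R (x \<bullet> g x)"
        unfolding dual_point_def
      proof (rule the_equality)
        show "x \<bullet> (g x /\<^sub>R (x \<bullet> g x)) = 1 \<and> (\<forall>z'\<in>K. z' \<bullet> (g x /\<^sub>R (x \<bullet> g x)) \<le> 1)"
          using y unfolding G(1)[OF y, symmetric] .
      qed (rule G)
      with G(2)[OF y] show ?thesis by simp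
    qed
    note dp = dual[OF IntI[OF p U(2)]]
    show "\<forall>w. w \<bullet> dual_point K p = 0 \<longrightarrow> tangent_dir (frontier K) p w"
      using dp tan[OF IntI[OF p U(2)]] by simp
    obtain r where r: "0 < r" "ball p r \<subseteq> U" using U(1,2) openE by blast
    have "(\<lambda>x. g x /\<^sub>R (x \<bullet> g x)) differentiable (at p within frontier K)"
    proof -
      have "g differentiable (at p within frontier K)"
        using g(1)[OF U(2)] differentiableI differentiable_at_withinI by blast
      then show ?thesis using dp
        by (intro differentiable_scaleR differentiable_inverse differentiable_inner differentiable_ident) auto
    qed
    then obtain L where "((\<lambda>x. g x /\<^sub>R (x \<bullet> g x)) has_derivative L) (at p within frontier K)"
      unfolding differentiable_def by blast
    \<comment> \<open>The formula is known to equal the dual point only on the boundary inside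
      \<open>U\<close>, so it is transferred within radius \<open>r\<close>.\<close>
    then have "(dual_point K has_derivative L) (at p within frontier K)"
      using r dual
      by (elim has_derivative_transform_within[OF _ r(1) p]) (auto simp: subset_iff dist_commute)
    then show "\<exists>L. (dual_point K has_derivative L) (at p within frontier K)" by blast
  qed
qed

section \<open>The Gauss map and the support function of a regular body\<close>

lemma frontier_maximizer:
  fixes K :: "'a::real_inner set"
  assumes "p \<in> K" "u \<noteq> 0" "\<And>y. y \<in> K \<Longrightarrow> y \<bullet> u \<le> p \<bullet> u"
  shows "p \<in> frontier K"
proof -
  have "p \<notin> interior K"
  proof
    assume "p \<in> interior K"
    then obtain e where e: "0 < e" "ball p e \<subseteq> K" using mem_interior by blast
    let ?y = "p + (e / 2 / norm u) *\<^sub>R u"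
    have "?y \<in> K" using e assms(2) by (auto simp: subset_iff dist_norm)
    then have "?y \<bullet> u \<le> p \<bullet> u" using assms(3) by blast
    moreover have "0 < (e / 2 / norm u) * (u \<bullet> u)" using e assms(2) by simp
    ultimately show False by (simp add: inner_add_left)
  qed
  then show ?thesis using assms(1) closure_subset by (auto simp: frontier_def)
qed

context
  fixes K :: "(real^'n::finite) set"
  assumes K: "regular_body K"
begin

lemma regular_body_frontier_subset: "frontier K \<subseteq> K"
  using K by (simp add: regular_body_def compact_imp_closed frontier_subset_closed)

lemma outer_normal_maximizer:
  assumes "p \<in> K" "norm u = 1" "\<And>y. y \<in> K \<Longrightarrow> y \<bullet> u \<le> p \<bullet> u"
  shows "p \<in> frontier K" "outer_normal K p = u"
proof -
  show p: "p \<in> frontier K" using assms by (intro frontier_maximizer[of p K u]) auto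
  show "outer_normal K p = u"
    using outer_normal_iff[OF K p, of u] outer_normal_eq[OF K p] assms by simp
qed

lemma outer_normal_unit_max:
  assumes "p \<in> frontier K"
  shows "norm (outer_normal K p) = 1" "y \<in> K \<Longrightarrow> y \<bullet> outer_normal K p \<le> p \<bullet> outer_normal K p"
  using outer_normal_iff[OF K assms, of "outer_normal K p"] outer_normal_eq[OF K assms] by auto

lemma support_function_eq:
  assumes "p \<in> frontier K"
  shows "support_function K (outer_normal K p) = p \<bullet> outer_normal K p"
  unfolding support_function_def
  using assms outer_normal_unit_max[OF assms] regular_body_frontier_subset
  by (intro cSup_eq_maximum) auto

lemma support_function_dual_point:
  assumes "p \<in> frontier K"
  shows "support_function K (outer_normal K p) = 1 / norm (dual_point K p)"
  unfolding support_function_eq[OF assms] using dual_point(1)[OF K assms]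
  by (simp add: outer_normal_eq[OF K assms] divide_inverse)

lemma exists_outer_normal:
  assumes "norm u = 1"
  shows "\<exists>p\<in>frontier K. outer_normal K p = u"
proof -
  have "compact K" "K \<noteq> {}" using K interior_subset by (auto simp: regular_body_def)
  moreover have "continuous_on K (\<lambda>x. x \<bullet> u)" by (intro continuous_intros)
  ultimately obtain p where "p \<in> K" "\<And>y. y \<in> K \<Longrightarrow> y \<bullet> u \<le> p \<bullet> u"
    using continuous_attains_sup[of K "\<lambda>x. x \<bullet> u"] by blast
  then show ?thesis using outer_normal_maximizer assms by blast
qed

text \<open>If \<open>p \<noteq> q\<close> have the same normal, so has the whole segment between them, and its direction lies
  in the kernel of the Weingarten map.\<close>

lemma inj_on_outer_normal:
  assumes curv: "\<And>p. p \<in> frontier K \<Longrightarrow> gauss_curvature K p \<noteq> 0"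
  shows "inj_on (outer_normal K) (frontier K)"
proof (rule inj_onI, rule ccontr)
  fix p q assume p: "p \<in> frontier K" and q: "q \<in> frontier K"
    and eq: "outer_normal K p = outer_normal K q" and "p \<noteq> q"
  define u where "u = outer_normal K p"
  note pm = outer_normal_unit_max[OF p, folded u_def] and qm = outer_normal_unit_max[OF q, folded eq, folded u_def]
  have pq: "p \<in> K" "q \<in> K" using p q regular_body_frontier_subset by auto
  then have "p \<bullet> u = q \<bullet> u" using pm(2) qm(2) by (simp add: antisym)
  then have perp: "(q - p) \<bullet> u = 0" by (simp add: inner_diff_left)
  \<comment> \<open>With step 1 / (k + 1) the secant quotient is constantly q - p, so q - p is a
    direction along which the derivative at \<open>p\<close> is determined.\<close>
  define x where "x k = p + inverse (real (Suc k)) *\<^sub>R (q - p)" for k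
  have x: "x k \<in> frontier K" "outer_normal K (x k) = u" for k
  proof -
    have "convex K" using K by (simp add: regular_body_def)
    moreover have "x k = (1 - inverse (real (Suc k))) *\<^sub>R p + inverse (real (Suc k)) *\<^sub>R q"
      by (simp add: x_def algebra_simps)
    moreover have "inverse (real (Suc k)) \<le> 1" by (simp add: inverse_le_1_iff)
    ultimately have "x k \<in> K" using pq by (simp add: convexD_alt)
    moreover have "x k \<bullet> u = p \<bullet> u" using perp by (simp add: x_def inner_add_left)
    ultimately show "x k \<in> frontier K" "outer_normal K (x k) = u"
      using outer_normal_maximizer[of "x k" u] pm by auto
  qed
  define D where "D = (SOME D. (outer_normal K has_derivative D) (at p within frontier K))"
  obtain L where "(dual_point K has_derivative L) (at p within frontier K)"
    using K p unfolding regular_body_def by blast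
  then have D: "(outer_normal K has_derivative D) (at p within frontier K)"
    unfolding D_def by (rule someI[where P = "\<lambda>D. (outer_normal K has_derivative D) (at p within frontier K)",
      OF outer_normal_has_derivative[OF K p]])
  have "(\<lambda>k. (outer_normal K (x k) - outer_normal K p) /\<^sub>R inverse (real (Suc k))) \<longlonglongrightarrow> D (q - p)"
    by (rule has_derivative_along_sequence[OF D x(1) _ LIMSEQ_inverse_real_of_nat]) (simp_all add: x_def)
  then have "D (q - p) = 0"
    using x(2) by (simp add: u_def LIMSEQ_const_iff)
  have linD: "linear D" using D has_derivative_linear by blast
  let ?M = "\<lambda>x. D (x - (x \<bullet> u) *\<^sub>R u) + (x \<bullet> u) *\<^sub>R u"
  have linM: "linear ?M"
    by (rule linearI)
      (auto simp: algebra_simps linear_add[OF linD] linear_diff[OF linD] linear_cmul[OF linD])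
  have "?M (q - p) = ?M 0" using perp \<open>D (q - p) = 0\<close> linear_0[OF linD] by simp
  then have "\<not> inj ?M" using \<open>p \<noteq> q\<close> by (metis (no_types, lifting) injD right_minus_eq)
  then have "det (matrix ?M) = 0" using det_nz_iff_inj[OF linM] by blast
  then show False
    using curv[OF p] by (simp add: gauss_curvature_def Let_def u_def D_def)
qed

text \<open>Injectivity of the Gauss map makes the \<open>THE\<close> in
  \<open>curvature_function\<close> return \<open>p\<close>.\<close>

lemma curvature_function_eq:
  assumes "\<And>p. p \<in> frontier K \<Longrightarrow> gauss_curvature K p \<noteq> 0" "p \<in> frontier K"
  shows "curvature_function K (outer_normal K p) = 1 / gauss_curvature K p"
proof -
  have "(THE q. q \<in> frontier K \<and> outer_normal K q = outer_normal K p) = p"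
    using inj_on_outer_normal[OF assms(1)] assms(2) by (auto dest: inj_onD)
  then show ?thesis by (simp add: curvature_function_def)
qed

end

section \<open>Behaviour under linear maps\<close>

context
  fixes T S :: "real^'n::finite \<Rightarrow> real^'n" and K :: "(real^'n) set"
  assumes T: "linear T" and S: "linear S" and ST: "\<And>x. S (T x) = x" and TS: "\<And>x. T (S x) = x"
    and K: "regular_body K"
begin

lemma frontier_image_inverse: "frontier (T ` K) = T ` frontier K"
proof -
  have "bij T" using ST TS by (intro o_bij[of S]) auto
  then have "inj T" by (rule bij_is_inj)
  have "closed K" using K by (simp add: regular_body_def compact_imp_closed)
  then have "closed (T ` K)" using T \<open>inj T\<close> closed_injective_linear_image by blast
  then show ?thesis
    using \<open>closed K\<close> \<open>inj T\<close> interior_bijective_linear_image[OF T \<open>bij T\<close>]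
    by (simp add: frontier_def image_set_diff)
qed

lemma inner_adjoint_inverse: "T x \<bullet> adjoint S y = x \<bullet> y"
  using adjoint_works[OF S, of "T x" y] ST by simp

lemma supports_image_iff:
  "T p \<bullet> y = 1 \<and> (\<forall>x\<in>T ` K. x \<bullet> y \<le> 1) \<longleftrightarrow> p \<bullet> adjoint T y = 1 \<and> (\<forall>x\<in>K. x \<bullet> adjoint T y \<le> 1)"
  by (simp add: adjoint_works[OF T])

lemma adjoint_inverse: "adjoint S (adjoint T y) = y" "adjoint T (adjoint S y) = y"
proof -
  have "x \<bullet> adjoint S (adjoint T y) = x \<bullet> y" for x
    by (simp only: adjoint_works[OF S] adjoint_works[OF T] TS)
  then show "adjoint S (adjoint T y) = y" by (rule vector_eq_ldot[THEN iffD1, OF allI])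
  have "x \<bullet> adjoint T (adjoint S y) = x \<bullet> y" for x
    by (simp only: adjoint_works[OF S] adjoint_works[OF T] ST)
  then show "adjoint T (adjoint S y) = y" by (rule vector_eq_ldot[THEN iffD1, OF allI])
qed

lemma supports_image_unique:
  assumes p: "p \<in> frontier K"
  shows "T p \<bullet> y = 1 \<and> (\<forall>x\<in>T ` K. x \<bullet> y \<le> 1) \<longleftrightarrow> y = adjoint S (dual_point K p)"
  unfolding supports_image_iff
proof
  assume "p \<bullet> adjoint T y = 1 \<and> (\<forall>x\<in>K. x \<bullet> adjoint T y \<le> 1)"
  then have "adjoint T y = dual_point K p" by (intro dual_point_unique[OF K p]) auto
  then show "y = adjoint S (dual_point K p)" using adjoint_inverse(1) by metis
next
  assume "y = adjoint S (dual_point K p)"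
  then show "p \<bullet> adjoint T y = 1 \<and> (\<forall>x\<in>K. x \<bullet> adjoint T y \<le> 1)"
    using dual_point(1,2)[OF K p] by (simp add: adjoint_inverse(2))
qed

lemma dual_point_image:
  assumes "p \<in> frontier K"
  shows "dual_point (T ` K) (T p) = adjoint S (dual_point K p)"
  unfolding dual_point_def[of "T ` K"] supports_image_unique[OF assms] by simp

text \<open>On the image boundary the dual point map is \<open>adjoint S\<close> after
  \<open>dual_point K\<close> after \<open>S\<close>, so this is the chain rule within the
  boundary.\<close>

lemma dual_point_image_has_derivative:
  assumes p: "p \<in> frontier K" and L: "(dual_point K has_derivative L) (at p within frontier K)"
  shows "(dual_point (T ` K) has_derivative (\<lambda>x. adjoint S (L (S x)))) (at (T p) within frontier (T ` K))"
proof -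
  have "S ` (T ` frontier K) = frontier K" using ST by (simp add: image_image)
  then have "(dual_point K has_derivative L) (at (S (T p)) within S ` frontier (T ` K))"
    using L ST by (simp add: frontier_image_inverse)
  with linear_imp_has_derivative[OF S]
  have "((\<lambda>x. dual_point K (S x)) has_derivative (\<lambda>x. L (S x))) (at (T p) within frontier (T ` K))"
    by (rule has_derivative_in_compose)
  from has_derivative_compose[OF this linear_imp_has_derivative[OF adjoint_linear[OF S]]]
  have "((\<lambda>x. adjoint S (dual_point K (S x))) has_derivative (\<lambda>x. adjoint S (L (S x))))
      (at (T p) within frontier (T ` K))" .
  then show ?thesis
    by (rule has_derivative_transform_within[OF _ zero_less_one])
      (use p in \<open>auto simp: frontier_image_inverse dual_point_image ST\<close>)
qed

lemma tangent_dir_image: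
  assumes "tangent_dir F p w"
  shows "tangent_dir (T ` F) (T p) (T w)"
proof -
  obtain x and t :: "nat \<Rightarrow> real" where xt: "\<And>k. x k \<in> F" "\<And>k. 0 < t k" "t \<longlonglongrightarrow> 0"
      "(\<lambda>k. (x k - p) /\<^sub>R t k) \<longlonglongrightarrow> w"
    using assms unfolding tangent_dir_def by blast
  have "bounded_linear T" using T by (simp add: linear_linear)
  from bounded_linear.tendsto[OF this xt(4)]
  have "(\<lambda>k. (T (x k) - T p) /\<^sub>R t k) \<longlonglongrightarrow> T w"
    by (simp add: linear_cmul[OF T] linear_diff[OF T])
  then show ?thesis
    unfolding tangent_dir_def using xt by (intro exI[of _ "\<lambda>k. T (x k)"] exI[of _ t]) simp
qed

lemma regular_body_image: "regular_body (T ` K)"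
  unfolding regular_body_def
proof (intro conjI ballI)
  have "bij T" using ST TS by (intro o_bij[of S]) auto
  show "convex (T ` K)" using K T by (simp add: regular_body_def convex_linear_image)
  show "compact (T ` K)"
    using K T by (auto simp: regular_body_def linear_linear intro!: compact_continuous_image linear_continuous_on)
  show "0 \<in> interior (T ` K)"
    using K linear_0[OF T] unfolding interior_bijective_linear_image[OF T \<open>bij T\<close>] regular_body_def
    by (metis imageI)
  fix q assume "q \<in> frontier (T ` K)"
  then obtain p where p: "p \<in> frontier K" and q: "q = T p" by (auto simp: frontier_image_inverse)
  show "\<exists>!y. q \<bullet> y = 1 \<and> (\<forall>x\<in>T ` K. x \<bullet> y \<le> 1)"
    unfolding q supports_image_unique[OF p] by simp
  obtain L where "(dual_point K has_derivative L) (at p within frontier K)"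
    using K p unfolding regular_body_def by blast
  then show "\<exists>L. (dual_point (T ` K) has_derivative L) (at q within frontier (T ` K))"
    unfolding q using dual_point_image_has_derivative[OF p] by blast
  show "\<forall>w. w \<bullet> dual_point (T ` K) q = 0 \<longrightarrow> tangent_dir (frontier (T ` K)) q w"
  proof (intro allI impI)
    fix w assume "w \<bullet> dual_point (T ` K) q = 0"
    then have "T (S w) \<bullet> adjoint S (dual_point K p) = 0"
      by (simp add: q dual_point_image[OF p] TS)
    then have "S w \<bullet> dual_point K p = 0" by (simp only: inner_adjoint_inverse)
    then have "tangent_dir (frontier K) p (S w)" using K p unfolding regular_body_def by blast
    from tangent_dir_image[OF this] show "tangent_dir (frontier (T ` K)) q w"
      by (simp add: q TS frontier_image_inverse)
  qed
qed

text \<open>By \<open>gauss_curvature_eq\<close> both sides are determinants of extended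
  differentials, up to the square. That for the image is \<Lambda> with \<open>S\<close> in front of
  its argument and \<open>adjoint S\<close> after its value; each of the two has determinant 1 / det
  T.\<close>

lemma gauss_curvature_image:
  assumes p: "p \<in> frontier K"
  shows "gauss_curvature (T ` K) (T p) * norm (dual_point (T ` K) (T p)) ^ (CARD('n) + 1) * det (matrix T) ^ 2
    = gauss_curvature K p * norm (dual_point K p) ^ (CARD('n) + 1)"
proof -
  obtain L where L: "(dual_point K has_derivative L) (at p within frontier K)"
    using K p unfolding regular_body_def by blast
  have linL: "linear L" using L has_derivative_linear by blast
  define \<nu> where "\<nu> = dual_point K p"
  define \<Lambda> where "\<Lambda> x = L (x - (x \<bullet> \<nu>) *\<^sub>R p) + (x \<bullet> \<nu>) *\<^sub>R \<nu>" for x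
  have lin\<Lambda>: "linear \<Lambda>" unfolding \<Lambda>_def
    by (rule linearI) (auto simp: algebra_simps linear_add[OF linL] linear_diff[OF linL] linear_cmul[OF linL])
  have linA: "linear (adjoint S)" by (rule adjoint_linear[OF S])
  have Tp: "T p \<in> frontier (T ` K)" using p by (simp add: frontier_image_inverse)
  have nz: "norm (dual_point K p) \<noteq> 0" "norm (dual_point (T ` K) (T p)) \<noteq> 0"
    using dual_point(3)[OF K p] dual_point(3)[OF regular_body_image Tp] by simp_all
  have "adjoint S (L (S (x - (x \<bullet> adjoint S \<nu>) *\<^sub>R T p))) + (x \<bullet> adjoint S \<nu>) *\<^sub>R adjoint S \<nu>
      = adjoint S (\<Lambda> (S x))" for x
  proof -
    have "x \<bullet> adjoint S \<nu> = S x \<bullet> \<nu>" by (rule adjoint_works[OF S])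
    then show ?thesis
      by (simp add: \<Lambda>_def linear_add[OF linA] linear_cmul[OF linA] linear_diff[OF S] linear_cmul[OF S] ST)
  qed
  then have "gauss_curvature (T ` K) (T p) * norm (dual_point (T ` K) (T p)) ^ (CARD('n) + 1)
      = det (matrix (\<lambda>x. adjoint S (\<Lambda> (S x))))"
    using gauss_curvature_eq[OF regular_body_image Tp dual_point_image_has_derivative[OF p L]] nz(2)
    by (simp add: dual_point_image[OF p] \<nu>_def)
  also have "\<dots> = det (matrix S) * (det (matrix \<Lambda>) * det (matrix S))"
  proof -
    have "linear (\<lambda>x. \<Lambda> (S x))" using linear_compose[OF S lin\<Lambda>] by (simp add: o_def)
    from det_matrix_compose[OF linA this] det_matrix_compose[OF lin\<Lambda> S] show ?thesis
      by (simp add: matrix_adjoint[OF S])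
  qed
  also have "det (matrix \<Lambda>) = gauss_curvature K p * norm (dual_point K p) ^ (CARD('n) + 1)"
    using gauss_curvature_eq[OF K p L] nz(1) by (simp add: \<Lambda>_def[abs_def] \<nu>_def)
  finally have *: "gauss_curvature (T ` K) (T p) * norm (dual_point (T ` K) (T p)) ^ (CARD('n) + 1)
      = det (matrix S) ^ 2 * (gauss_curvature K p * norm (dual_point K p) ^ (CARD('n) + 1))"
    by (simp add: power2_eq_square)
  have "det (matrix S) * det (matrix T) = 1"
    using det_matrix_compose[OF S T] by (simp add: ST matrix_id_mat_1[unfolded id_def])
  then have "det (matrix S) ^ 2 * det (matrix T) ^ 2 = 1"
    by (simp flip: power_mult_distrib)
  then show ?thesis unfolding * by (simp add: mult.commute mult.left_commute)
qed

end

text \<open>Pick a point \<open>T p\<close> of the image with outer normal \<open>u\<close>. The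
  dual point of \<open>K\<close> at \<open>p\<close> is \<open>adjoint T\<close> of the one at
  \<open>T p\<close>, so the normal at \<open>p\<close> is \<open>v\<close>, and the ratio of the
  two lengths gives the factor in the support function.\<close>

lemma support_curvature_image:
  fixes T :: "real^'n::finite \<Rightarrow> real^'n"
  assumes K: "K \<in> C2_plus" and T: "linear T" "bij T" and u: "norm u = 1"
  defines "v \<equiv> adjoint T u /\<^sub>R norm (adjoint T u)"
  shows "support_function (T ` K) u = norm (adjoint T u) * support_function K v"
    and "curvature_function (T ` K) u * support_function (T ` K) u ^ (CARD('n) + 1)
      = det (matrix T) ^ 2 * (curvature_function K v * support_function K v ^ (CARD('n) + 1))"
    and "0 < support_function K v" "0 < curvature_function K v"
proof -
  note R = C2_plus_regular_body[OF K]
  have curv: "\<And>p. p \<in> frontier K \<Longrightarrow> 0 < gauss_curvature K p" using K by (simp add: C2_plus_def)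
  obtain S where S: "linear S" "S \<circ> T = id"
    using T bij_is_inj linear_injective_left_inverse by blast
  have "T \<circ> S = id" using S linear_inverse_left[OF T(1) S(1)] by blast
  then have ST: "\<And>x. S (T x) = x" and TS: "\<And>x. T (S x) = x" using S(2) by (simp_all add: fun_eq_iff)
  note img = T(1) S(1) ST TS R
  note RT = regular_body_image[OF img]
  have d: "det (matrix T) \<noteq> 0" using det_nz_iff_inj[OF T(1)] T(2) by (simp add: bij_is_inj)
  \<comment> \<open>Nonvanishing curvature of the image is read off the transformation formula; it
    makes the curvature function of the image evaluate at \<open>q\<close>.\<close>
  have curvT: "gauss_curvature (T ` K) q \<noteq> 0" if Fq: "q \<in> frontier (T ` K)" for q
  proof -
    obtain p where p: "p \<in> frontier K" "q = T p"
      using Fq unfolding frontier_image_inverse[OF img] by blast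
    have "gauss_curvature K p * norm (dual_point K p) ^ (CARD('n) + 1) \<noteq> 0"
      using curv[OF p(1)] dual_point(3)[OF R p(1)] by simp
    then show ?thesis using gauss_curvature_image[OF img p(1)] p(2) by auto
  qed
  obtain q where q: "q \<in> frontier (T ` K)" "outer_normal (T ` K) q = u"
    using exists_outer_normal[OF RT u] by blast
  then obtain p where p: "p \<in> frontier K" "q = T p"
    unfolding frontier_image_inverse[OF img] by blast
  let ?\<nu> = "dual_point K p" and ?\<nu>' = "dual_point (T ` K) q"
  have \<nu>: "?\<nu> \<noteq> 0" "?\<nu>' \<noteq> 0" using dual_point(3)[OF R p(1)] dual_point(3)[OF RT q(1)] .
  have linA: "linear (adjoint T)" by (rule adjoint_linear[OF T(1)])
  have "?\<nu> = adjoint T ?\<nu>'"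
    using dual_point_image[OF img p(1)] p(2) adjoint_inverse(2)[OF img] by simp
  also have "?\<nu>' = norm ?\<nu>' *\<^sub>R u"
    using outer_normal_eq[OF RT q(1)] q(2) \<nu>(2) by auto
  finally have \<nu>_eq: "?\<nu> = norm ?\<nu>' *\<^sub>R adjoint T u" by (simp add: linear_cmul[OF linA])
  then have norm_eq: "norm ?\<nu> = norm ?\<nu>' * norm (adjoint T u)" by (metis abs_norm_cancel norm_scaleR)
  have v: "outer_normal K p = v"
    unfolding outer_normal_eq[OF R p(1)] norm_eq unfolding \<nu>_eq v_def using \<nu>(2) by simp
  have h: "support_function K v = 1 / norm ?\<nu>" "support_function (T ` K) u = 1 / norm ?\<nu>'"
    using support_function_dual_point[OF R p(1)] support_function_dual_point[OF RT q(1)] v q(2) by simp_all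
  have f: "curvature_function K v = 1 / gauss_curvature K p"
      "curvature_function (T ` K) u = 1 / gauss_curvature (T ` K) q"
    using curvature_function_eq[OF R _ p(1)] curv curvature_function_eq[OF RT curvT q(1)] v q(2)
    by (simp_all add: less_imp_neq[THEN not_sym])
  show "support_function (T ` K) u = norm (adjoint T u) * support_function K v"
    using norm_eq \<nu> unfolding h by (auto simp: divide_simps)
  have "gauss_curvature K p \<noteq> 0" using curv[OF p(1)] by simp
  then show "curvature_function (T ` K) u * support_function (T ` K) u ^ (CARD('n) + 1)
      = det (matrix T) ^ 2 * (curvature_function K v * support_function K v ^ (CARD('n) + 1))"
    using gauss_curvature_image[OF img p(1)] curvT[OF q(1)] \<nu> unfolding f h p(2)[symmetric]
    by (simp add: power_one_over divide_simps mult_ac)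
  show "0 < support_function K v" "0 < curvature_function K v"
    using \<nu> curv[OF p(1)] by (simp_all add: h f)
qed

text \<open>The squared determinant is absorbed into the functions \<open>\<psi> i\<close>, so both
  claims of the theorem reduce to comparing rescaled functions on the same bodies.\<close>

lemma as_star_linear_image:
  fixes T :: "real^'n::finite \<Rightarrow> real^'n" and K :: "'n \<Rightarrow> (real^'n) set"
  assumes T: "linear T" "bij T" and \<psi>: "\<And>i. \<psi> i \<in> Conv_pos" and K: "\<And>i. K i \<in> C2_plus"
  shows "as_star \<psi> (\<lambda>i. T ` K i) = as_star (\<lambda>i t. \<psi> i (det (matrix T) ^ 2 * t)) K / \<bar>det (matrix T)\<bar>"
proof -
  let ?n = "CARD('n)" and ?A = "adjoint T" and ?d = "det (matrix T)"
  let ?X = "\<lambda>i v. curvature_function (K i) v * support_function (K i) v ^ (?n + 1)"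
  define F where "F v = (\<Prod>i\<in>UNIV. (\<psi> i (?d ^ 2 * ?X i v) / support_function (K i) v ^ ?n) powr (1 / ?n))" for v
  have linA: "linear ?A" by (rule adjoint_linear[OF T(1)])
  have d: "?d \<noteq> 0" using det_nz_iff_inj[OF T(1)] T(2) by (simp add: bij_is_inj)
  have detA: "det (matrix ?A) = ?d" by (simp add: matrix_adjoint[OF T(1)])
  then have injA: "inj ?A" using d det_nz_iff_inj[OF linA] by simp
  have "as_star \<psi> (\<lambda>i. T ` K i) = (LINT u|sphere_measure. F (?A u /\<^sub>R norm (?A u)) / norm (?A u) ^ ?n)"
    unfolding as_star_def
  proof (rule Bochner_Integration.integral_cong[OF refl])
    fix u :: "real^'n" assume "u \<in> space sphere_measure"
    then have u: "norm u = 1" by simp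
    define v where "v = ?A u /\<^sub>R norm (?A u)"
    define a where "a = norm (?A u)"
    have "?A u \<noteq> 0" using injA u linear_injective_0[OF linA] by (metis norm_zero zero_neq_one)
    then have a: "0 < a" by (simp add: a_def)
    note X = support_curvature_image[OF K T u, folded v_def a_def]
    \<comment> \<open>The power a^n in the denominator becomes a single a under the n-th root; the
      product over the n indices restores a^n, exactly the weight that
      \<open>integral_spherical_image\<close> expects for \<open>adjoint T\<close>.\<close>
    have eq: "(\<psi> i (curvature_function (T ` K i) u * support_function (T ` K i) u ^ (?n + 1))
          / support_function (T ` K i) u ^ ?n) powr (1 / ?n)
        = (\<psi> i (?d ^ 2 * ?X i v) / support_function (K i) v ^ ?n) powr (1 / ?n) / a" for i
    proof -
      have "0 < \<psi> i (?d ^ 2 * ?X i v)"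
        using \<psi>[of i] X(3,4)[of i] d by (simp add: Conv_pos_def)
      moreover have "(y / (a * z) ^ ?n) powr (1 / ?n) = (y / z ^ ?n) powr (1 / ?n) / a"
        if "0 < y" "0 < z" for y z
      proof -
        have "(a ^ ?n) powr (1 / ?n) = a"
          using a by (simp add: powr_powr flip: powr_realpow)
        then show ?thesis
          using a that by (simp add: power_mult_distrib powr_divide powr_mult)
      qed
      ultimately show ?thesis
        unfolding X(2) unfolding X(1)[of i] using X(3)[of i] by blast
    qed
    show "(\<Prod>i\<in>UNIV. (\<psi> i (curvature_function (T ` K i) u * support_function (T ` K i) u ^ (?n + 1))
          / support_function (T ` K i) u ^ ?n) powr (1 / ?n)) = F (?A u /\<^sub>R norm (?A u)) / norm (?A u) ^ ?n"
      unfolding F_def v_def[symmetric] unfolding a_def[symmetric] eq prod_dividef by simp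
  qed
  also have "\<dots> = (LINT u|sphere_measure. F u) / \<bar>?d\<bar>"
    by (simp only: integral_spherical_image[OF linA injA] detA)
  finally show ?thesis by (simp only: as_star_def F_def)
qed

text \<open>The positivity clauses of \<open>support_curvature_image\<close> for the identity map,
  where \<open>v\<close> is \<open>u\<close> itself.\<close>

lemma support_curvature_pos:
  fixes K :: "(real^'n::finite) set"
  assumes "K \<in> C2_plus" "norm u = 1"
  shows "0 < support_function K u" "0 < curvature_function K u"
proof -
  have "adjoint (\<lambda>x. x) = (\<lambda>x. x :: real^'n)" by (rule adjoint_unique) simp
  then show "0 < support_function K u" "0 < curvature_function K u"
    using support_curvature_image(3,4)[OF assms(1) linear_ident bij_id[unfolded id_def] assms(2)] assms(2)
    by simp_all
qed

text \<open>Homogeneity speaks of positive arguments only, which is why positivity of curvature and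
  support functions enters. The factors c^(r i / n) do not depend on \<open>u\<close> and leave the
  integral.\<close>

lemma as_star_homogeneous:
  fixes K :: "'n::finite \<Rightarrow> (real^'n) set"
  assumes K: "\<And>i. K i \<in> C2_plus" and \<psi>: "\<And>i. \<psi> i \<in> Conv_pos"
    and hom: "\<And>i. homogeneous_of_degree (r i) (\<psi> i)" and "0 < c"
  shows "as_star (\<lambda>i t. \<psi> i (c * t)) K = c powr ((\<Sum>i\<in>UNIV. r i) / CARD('n)) * as_star \<psi> K"
proof -
  let ?n = "CARD('n)"
  let ?X = "\<lambda>i v. curvature_function (K i) v * support_function (K i) v ^ (?n + 1)"
  have "as_star (\<lambda>i t. \<psi> i (c * t)) K = (LINT u|sphere_measure. c powr ((\<Sum>i\<in>UNIV. r i) / ?n)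
      * (\<Prod>i\<in>UNIV. (\<psi> i (?X i u) / support_function (K i) u ^ ?n) powr (1 / ?n)))"
    unfolding as_star_def
  proof (rule Bochner_Integration.integral_cong[OF refl])
    fix u :: "real^'n" assume "u \<in> space sphere_measure"
    then have u: "norm u = 1" by simp
    have "(\<psi> i (c * ?X i u) / support_function (K i) u ^ ?n) powr (1 / ?n)
      = c powr (r i / ?n) * (\<psi> i (?X i u) / support_function (K i) u ^ ?n) powr (1 / ?n)" for i
    proof -
      note pos = support_curvature_pos[OF K[of i] u]
      then have "0 < ?X i u" by simp
      then have "\<psi> i (c * ?X i u) = c powr r i * \<psi> i (?X i u)" "0 < \<psi> i (?X i u)"
        using hom[of i] \<psi>[of i] \<open>0 < c\<close> by (simp_all add: homogeneous_of_degree_def Conv_pos_def)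
      moreover have "(c powr r i * y / z) powr (1 / ?n) = c powr (r i / ?n) * (y / z) powr (1 / ?n)"
        if "0 < y" "0 < z" for y z
        using that \<open>0 < c\<close> by (simp add: powr_mult powr_divide powr_powr)
      moreover have "0 < support_function (K i) u ^ ?n" using pos by simp
      ultimately show ?thesis by (simp only:)
    qed
    then show "(\<Prod>i\<in>UNIV. (\<psi> i (c * ?X i u) / support_function (K i) u ^ ?n) powr (1 / ?n))
      = c powr ((\<Sum>i\<in>UNIV. r i) / ?n) * (\<Prod>i\<in>UNIV. (\<psi> i (?X i u) / support_function (K i) u ^ ?n) powr (1 / ?n))"
      using \<open>0 < c\<close> by (simp add: prod.distrib powr_sum sum_divide_distrib)
  qed
  then show ?thesis by (simp add: as_star_def)
qed

theorem theorem2p4: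
  fixes T :: "real ^ 'n::finite \<Rightarrow> real ^ 'n"
    and \<psi> :: "'n \<Rightarrow> real \<Rightarrow> real"
    and K :: "'n \<Rightarrow> (real ^ 'n) set"
  assumes "CARD('n) \<ge> 2"
    and "linear T" and "bij T"
    and "\<And>i. \<psi> i \<in> Conv_pos"
    and "\<And>i. K i \<in> C2_plus"
  shows "(\<bar>det (matrix T)\<bar> = 1 \<longrightarrow> as_star \<psi> (\<lambda>i. T ` K i) = as_star \<psi> K) \<and>
    (\<forall>r :: 'n \<Rightarrow> real. (\<forall>i. r i \<le> 0 \<and> homogeneous_of_degree (r i) (\<psi> i)) \<longrightarrow>
       as_star \<psi> (\<lambda>i. T ` K i) =
         \<bar>det (matrix T)\<bar> powr (2 * (\<Sum>i\<in>UNIV. r i) / CARD('n) - 1) * as_star \<psi> K)"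
proof (intro conjI allI impI)
  let ?d = "det (matrix T)"
  note image = as_star_linear_image[OF assms(2-5)]
  show "as_star \<psi> (\<lambda>i. T ` K i) = as_star \<psi> K" if "\<bar>?d\<bar> = 1"
  proof -
    have "?d ^ 2 = 1" using that by (metis one_power2 power2_abs)
    then show ?thesis using that by (simp add: image)
  qed
  fix r :: "'n \<Rightarrow> real" assume r: "\<forall>i. r i \<le> 0 \<and> homogeneous_of_degree (r i) (\<psi> i)"
  let ?s = "(\<Sum>i\<in>UNIV. r i) / CARD('n)"
  have d: "0 < \<bar>?d\<bar>" using det_nz_iff_inj[OF assms(2)] assms(3) by (simp add: bij_is_inj)
  \<comment> \<open>The scaling factor is the square of det T, whence the 2 in the exponent; the
    quotient by the absolute determinant supplies the -1.\<close>
  have "as_star \<psi> (\<lambda>i. T ` K i) = (?d ^ 2) powr ?s * as_star \<psi> K / \<bar>?d\<bar>"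
    unfolding image using d r as_star_homogeneous[where K = K and \<psi> = \<psi> and r = r and c = "?d ^ 2"] assms(4,5) by simp
  also have "(?d ^ 2) powr ?s = \<bar>?d\<bar> powr (2 * ?s)"
  proof -
    have "?d ^ 2 = \<bar>?d\<bar> powr 2" using d by (simp add: powr_numeral)
    then show ?thesis by (simp only: powr_powr)
  qed
  also have "\<bar>?d\<bar> powr (2 * ?s) * as_star \<psi> K / \<bar>?d\<bar> = \<bar>?d\<bar> powr (2 * ?s - 1) * as_star \<psi> K"
    using d by (simp add: powr_diff)
  finally show "as_star \<psi> (\<lambda>i. T ` K i)
      = \<bar>?d\<bar> powr (2 * (\<Sum>i\<in>UNIV. r i) / CARD('n) - 1) * as_star \<psi> K"
    by simp
qed

end
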